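(* Suppose $\sup_{\ell\ge1}\ell|a_\ell|<\infty$. (a) Assume that for some $m\in\mathbb{N}$, $a_m>0$ and $a_{\ell m}\neq a_m$ for all $\ell>1$. Then there exists a non-trivial $m$-periodic branch of solutions $(\underline p(s),\kappa(s)):(-\delta,\delta)\to\ell^2_w\times\mathbb{R}_+$ of $F=\underline 0$ at the bifurcation point $2/a_m$ with the following description. Let $W^{(m)}(\theta):=\sum_{\ell=1}^\infty a_{\ell m}\cos\ell\theta$, and let $(\underline p^{(m)}(s),\kappa^{(m)}(s)):(-\delta^{(m)},\delta^{(m)})\to\ell^2_w\times\mathbb{R}_+$ be the unique non-trivial branch of solutions at the bifurcation point $\kappa_m:=2/a_m$ for the stationary McKean-Vlasov equation with potential $W^{(m)}$ (see context). Then $\delta=\delta^{(m)}$ and, for every $s\in(-\delta,\delta)$, $$\kappa(s)=\kappa^{(m)}(s),\qquad p_j(s)=0\ \text{ for all } j \text{ with } m\nmid j,\qquad p_{\ell m}(s)=p^{(m)}_\ell(s),\ \ \ell\in\mathbb{N}.$$ In particular, if $a_\ell\neq a_m$ for all $\ell\neq m$, this gives the unique non-trivial branch of solutions at the bifurcation point $2/a_m$. (b) Assume that for some $m\in\mathbb{N}$, $a_m>0$. Let $S:=\{\ell\in\mathbb{N}:a_\ell=a_m\}$. Further assume $\sum_{j=1}^\infty j^2a_j^2<\infty$ and $\gcd(S)=g>1$. Then for any non-trivial branch of solutions $(\underline p(s),\kappa(s)):(-\delta,\delta)\to\ell^2_w\times\mathbb{R}_+$ around the bifurcation point $2/a_m$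 (i.e. with $(\underline p(0),\kappa(0))=(\underline0,2/a_m)$), there exists $\delta'\in(0,\delta]$ such that $$p_\ell(s)=0\quad\text{for all } s\in(-\delta',\delta')\ \text{ whenever } g\nmid\ell,$$ i.e. the solution is $g$-periodic.
   Context: $(a_\ell)_{\ell\ge1}$ are the real Fourier coefficients of an even, square integrable potential $W(\theta)=\sum_{\ell\ge1}a_\ell\cos\ell\theta$ on $\mathbb{S}^1=[0,2\pi)$. $\mathbb{R}_+=(0,\infty)$. $\ell^2_w=\{\underline x:\sum_{\ell\ge1}(1+\ell^2)x_\ell^2<\infty\}$. The map $F:\ell^2_w\times\mathbb{R}_+\to\ell^2$ is $$F_\ell(\underline x,\kappa)=\ell(2-\kappa a_\ell)x_\ell-\kappa\sum_{1\le j<\ell}ja_jx_jx_{\ell-j}-\kappa\sum_{j>\ell}\big(ja_j-(j-\ell)a_{j-\ell}\big)x_jx_{j-\ell},\quad\ell\ge1.$$ Its zeros are exactly the Fourier modes $p_\ell=\frac1{2\pi}\int_0^{2\pi} p\cos\ell\theta\,d\theta$ ($\ell\ge1$) of even $H^1$ probability densities $p$ (w.r.t. $d\theta/2\pi$) solving $p''=\kappa(p(W\star p)')'$, where $(W\star p)(\theta)=\frac1{2\pi}\int_0^{2\pi} W(\theta-\phi)p(\phi)d\phi$. For the potential $W^{(m)}$ the corresponding map is obtained by replacing $a_\ell$ by $a_{\ell m}$. A non-trivial branch of solutions at $\kappa_b$ is a continuous curve $s\mapsto(\underline p(s),\kappa(s))$, $(-\delta,\delta)\to\ell^2_w\times\mathbb{R}_+$,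 with $(\underline p(0),\kappa(0))=(\underline0,\kappa_b)$, $F(\underline p(s),\kappa(s))=\underline0$ for all $s$, and meeting the axis $\{(\underline0,\kappa)\}$ at at most one $s$. Branch for $W^{(m)}$: under the hypotheses of (a), the first Fourier coefficient $a_m>0$ of $W^{(m)}$ differs from all its other coefficients; the branch meant is the one, locally unique near $(\underline 0,2/a_m)$, of the form $\underline p^{(m)}(s)=s e_1+o(s)$ with $\kappa^{(m)}$ twice differentiable, $\kappa^{(m)}(0)=2/a_m$, $(\kappa^{(m)})'(0)=0$, where $e_1$ is the first canonical basis vector. A solution is called $m$-periodic if its Fourier modes vanish at all indices not divisible by $m$. *)

theory Defs
  imports "HOL-Analysis.Analysis"
begin

(* W is an even function on the circle, square integrable over a period, whose Fourier
   expansion is sum_{l >= 1} a l * cos (l * theta); the mean of W is therefore zero.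
   The value a 0 carries no information. *)
definition even_potential :: "(real \<Rightarrow> real) \<Rightarrow> (nat \<Rightarrow> real) \<Rightarrow> bool" where
  "even_potential W a \<longleftrightarrow>
     (\<forall>\<theta>. W (\<theta> + 2 * pi) = W \<theta>) \<and> (\<forall>\<theta>. W (- \<theta>) = W \<theta>) \<and>
     W \<in> borel_measurable lebesgue \<and>
     set_integrable lebesgue {0..2*pi} (\<lambda>\<theta>. (W \<theta>)\<^sup>2) \<and>
     (LINT \<theta>:{0..2*pi}|lebesgue. W \<theta>) = 0 \<and>
     (\<forall>l\<ge>1. a l = (1 / pi) * (LINT \<theta>:{0..2*pi}|lebesgue. W \<theta> * cos (real l * \<theta>)))"

(* Sequences indexed by l >= 1 are functions on nat that vanish at the unused index 0. *)
definition ell2w :: "(nat \<Rightarrow> real) set" where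
  "ell2w = {x. x 0 = 0 \<and> summable (\<lambda>l. (1 + (real l)\<^sup>2) * (x l)\<^sup>2)}"

definition wnorm :: "(nat \<Rightarrow> real) \<Rightarrow> real" where
  "wnorm x = sqrt (\<Sum>l. (1 + (real l)\<^sup>2) * (x l)\<^sup>2)"

definition unit_seq :: "nat \<Rightarrow> nat \<Rightarrow> real" where
  "unit_seq k = (\<lambda>l. if l = k then 1 else 0)"

definition MV_map :: "(nat \<Rightarrow> real) \<Rightarrow> (nat \<Rightarrow> real) \<Rightarrow> real \<Rightarrow> nat \<Rightarrow> real" where
  "MV_map a x \<kappa> l =
     real l * (2 - \<kappa> * a l) * x l
     - \<kappa> * (\<Sum>j\<in>{1..<l}. real j * a j * x j * x (l - j))
     - \<kappa> * (\<Sum>\<^sub>\<infinity>j\<in>{l<..}. (real j * a j - real (j - l) * a (j - l)) * x j * x (j - l))"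

definition MV_zero :: "(nat \<Rightarrow> real) \<Rightarrow> (nat \<Rightarrow> real) \<Rightarrow> real \<Rightarrow> bool" where
  "MV_zero a x \<kappa> \<longleftrightarrow> (\<forall>l\<ge>1. MV_map a x \<kappa> l = 0)"

(* A curve on (-d, d) is given by total functions, of which only the values on that
   interval matter. *)
definition nontrivial_branch ::
  "(nat \<Rightarrow> real) \<Rightarrow> real \<Rightarrow> real \<Rightarrow> (real \<Rightarrow> nat \<Rightarrow> real) \<Rightarrow> (real \<Rightarrow> real) \<Rightarrow> bool" where
  "nontrivial_branch a \<kappa>\<^sub>b \<delta> p \<kappa> \<longleftrightarrow>
     0 < \<delta> \<and>
     (\<forall>s\<in>{-\<delta><..<\<delta>}. p s \<in> ell2w \<and> 0 < \<kappa> s) \<and>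
     (\<forall>s\<in>{-\<delta><..<\<delta>}.
        ((\<lambda>t. wnorm (\<lambda>l. p t l - p s l)) \<longlongrightarrow> 0) (at s within {-\<delta><..<\<delta>})) \<and>
     continuous_on {-\<delta><..<\<delta>} \<kappa> \<and>
     p 0 = (\<lambda>l. 0) \<and> \<kappa> 0 = \<kappa>\<^sub>b \<and>
     (\<forall>s\<in>{-\<delta><..<\<delta>}. MV_zero a (p s) (\<kappa> s)) \<and>
     (\<forall>s\<in>{-\<delta><..<\<delta>}. \<forall>t\<in>{-\<delta><..<\<delta>}. p s = (\<lambda>l. 0) \<and> p t = (\<lambda>l. 0) \<longrightarrow> s = t)"

(* The branch has the form p s = s * e_1 + o(s) in the weighted space, and kappa is twice
   differentiable with vanishing first derivative at 0. *)
definition first_mode_branch ::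
  "(nat \<Rightarrow> real) \<Rightarrow> real \<Rightarrow> real \<Rightarrow> (real \<Rightarrow> nat \<Rightarrow> real) \<Rightarrow> (real \<Rightarrow> real) \<Rightarrow> bool" where
  "first_mode_branch a \<kappa>\<^sub>b \<delta> p \<kappa> \<longleftrightarrow>
     nontrivial_branch a \<kappa>\<^sub>b \<delta> p \<kappa> \<and>
     ((\<lambda>s. wnorm (\<lambda>l. p s l - s * unit_seq 1 l) / \<bar>s\<bar>) \<longlongrightarrow> 0) (at 0) \<and>
     (\<exists>\<kappa>' \<kappa>''. (\<forall>s\<in>{-\<delta><..<\<delta>}.
                 (\<kappa> has_real_derivative \<kappa>' s) (at s) \<and>
                 (\<kappa>' has_real_derivative \<kappa>'' s) (at s)) \<and>
               \<kappa>' 0 = 0)"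

(* Uniqueness of a branch up to reparametrization, as a germ at the bifurcation point: near
   that point every zero off the trivial axis lies on the given curve. The quantification
   over all eta excludes that such zeros are only covered by a part of the curve that
   returns to the bifurcation point at parameters away from 0. *)
definition locally_unique_branch ::
  "(nat \<Rightarrow> real) \<Rightarrow> real \<Rightarrow> real \<Rightarrow> (real \<Rightarrow> nat \<Rightarrow> real) \<Rightarrow> (real \<Rightarrow> real) \<Rightarrow> bool" where
  "locally_unique_branch a \<kappa>\<^sub>b \<delta> p \<kappa> \<longleftrightarrow>
     (\<forall>\<eta>\<in>{0<..\<delta>}. \<exists>\<epsilon>>0. \<forall>x\<in>ell2w. \<forall>k>0.
        MV_zero a x k \<and> x \<noteq> (\<lambda>l. 0) \<and> wnorm x < \<epsilon> \<and> \<bar>k - \<kappa>\<^sub>b\<bar> < \<epsilon> \<longrightarrow>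
        (\<exists>s\<in>{-\<eta><..<\<eta>}. x = p s \<and> k = \<kappa> s))"

definition mode_periodic :: "nat \<Rightarrow> (nat \<Rightarrow> real) \<Rightarrow> bool" where
  "mode_periodic m x \<longleftrightarrow> (\<forall>l\<ge>1. \<not> m dvd l \<longrightarrow> x l = 0)"

(* Cosine coefficients of the potential sum_{l >= 1} a (l * m) * cos (l * theta). *)
definition rescaled_coeffs :: "nat \<Rightarrow> (nat \<Rightarrow> real) \<Rightarrow> nat \<Rightarrow> real" where
  "rescaled_coeffs m a = (\<lambda>l. a (l * m))"

end

theory Submission
  imports Defs
begin

text \<open>
  Write \<open>C\<close> for the bound on \<open>l * \<bar>a l\<bar>\<close>. After division by \<open>\<kappa>\<close> the equations become
  \<open>l * (2 / \<kappa> - a l) * x l = Q l x x\<close>, where \<open>Q l\<close> is a bilinear form that couples the modes \<open>j\<close>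
  and \<open>k\<close> only if \<open>j + k = l\<close> or \<open>j - k = l\<close>. A pair \<open>(j, k)\<close> thus acts on at most two modes
  \<open>l\<close>, with coefficients at most \<open>C\<close> and \<open>2 * C\<close>, so that
  \<open>(\<Sum>l. \<bar>Q l x y\<bar>) \<le> 3 * C * \<parallel>x\<parallel> * \<parallel>y\<parallel>\<close> in the \<open>\<ell>\<^sup>1\<close> norm (\<open>quad_bound\<close>). The weighted space embeds
  into \<open>\<ell>\<^sup>1\<close>, and \<open>(\<Sum>l. l * \<bar>x l\<bar>)\<close> controls the weighted norm in turn; all estimates
  are therefore made in \<open>\<ell>\<^sup>1\<close>. The linear part is bounded below, uniformly for \<open>\<kappa>\<close> near \<open>2 / a m\<close>,
  on all modes with \<open>a l \<noteq> a m\<close>, since \<open>a l\<close> tends to \<open>0\<close> and \<open>a m > 0\<close> (\<open>spectral_gap\<close>).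

  Periodicity. Let every mode with \<open>a l = a m\<close> be a multiple of \<open>g\<close>, and let \<open>z\<close> be the part of a
  zero \<open>x\<close> in the modes that \<open>g\<close> does not divide. Two multiples of \<open>g\<close> only excite multiples
  of \<open>g\<close>, so in the equations for \<open>z\<close> each quadratic term contains a factor from \<open>z\<close>. The gap
  gives \<open>\<parallel>z\<parallel> \<le> const * \<parallel>x\<parallel> * \<parallel>z\<parallel>\<close>, hence \<open>z = 0\<close> for small \<open>x\<close> (\<open>small_zero_periodic\<close>). This is
  part (b), and it reduces the uniqueness claim of part (a) for \<open>a\<close> to the one for the
  rescaled coefficients, because placing a sequence at the multiples of \<open>m\<close> turns zeros
  for the rescaled coefficients into zeros for \<open>a\<close> (\<open>MV_zero_spread\<close>).

  Uniqueness. Let only the first mode be critical. The gap bounds the higher modes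
  of a small zero \<open>x\<close> by \<open>\<parallel>x\<parallel>\<^sup>2\<close>, so its first mode \<open>t\<close> dominates. If two small
  zeros \<open>x\<close>, \<open>y\<close> share \<open>t \<noteq> 0\<close>, the equation of mode \<open>1\<close> bounds the difference
  of their parameters by \<open>\<parallel>x - y\<parallel>\<close>, and the remaining equations bound \<open>\<parallel>x - y\<parallel>\<close> by a small
  multiple of itself; the zeros coincide (\<open>zero_determined_by_first_mode\<close>). Along a branch
  \<open>s * e\<^sub>1 + o(s)\<close> the first mode takes all small values, by the intermediate value theorem, so
  the branch passes through every small nontrivial zero.

  Existence. With \<open>x = s * u\<close>, \<open>u 1 = 1\<close>, the equation of mode \<open>1\<close> gives
  \<open>2 / \<kappa> = a 1 + s * Q 1 u u\<close>, and the others turn into \<open>u = e\<^sub>1 + s * T u\<close> with \<open>T\<close> a sum of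
  a quadratic and a cubic map. The factor \<open>s\<close> determines the coefficients of a power series
  \<open>u = (\<Sum>n. s ^ n * U n)\<close> recursively, and a scalar majorant
  shows that it converges with values in the weighted space. Being a power series in \<open>s\<close>, \<open>\<kappa>\<close> is
  smooth, and \<open>\<kappa>' 0 = 0\<close> because mode \<open>1\<close> does not act on itself (\<open>first_mode_branch_exists\<close>).
\<close>

section \<open>Unconditional sums of reals\<close>

lemma summable_on_of_finite_bound:
  fixes f :: "'a \<Rightarrow> real"
  assumes "\<And>x. x \<in> A \<Longrightarrow> 0 \<le> f x" "\<And>F. finite F \<Longrightarrow> F \<subseteq> A \<Longrightarrow> sum f F \<le> B"
  shows "f summable_on A" "infsum f A \<le> B"
proof -
  show *: "f summable_on A"
    by (rule nonneg_bdd_above_summable_on) (use assms in \<open>auto intro!: bdd_aboveI2[where M=B]\<close>)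
  show "infsum f A \<le> B"
    by (rule infsum_le_finite_sums[OF *]) (use assms in auto)
qed

lemma abs_summable_on_real:
  fixes f :: "'a \<Rightarrow> real"
  shows "(\<lambda>x. \<bar>f x\<bar>) summable_on A \<longleftrightarrow> f summable_on A"
  using summable_on_iff_abs_summable_on_real[of f A] by simp

lemma summable_on_real_comparison:
  fixes f g :: "'a \<Rightarrow> real"
  assumes "g summable_on A" "\<And>x. x \<in> A \<Longrightarrow> \<bar>f x\<bar> \<le> g x"
  shows "f summable_on A"
proof -
  have "(\<lambda>x. norm (f x)) summable_on A"
    by (rule Infinite_Sum.abs_summable_on_comparison_test'[OF assms(1)]) (use assms(2) in simp)
  then show ?thesis by (simp add: abs_summable_on_real)
qed

lemma abs_infsum_le:
  fixes f g :: "'a \<Rightarrow> real"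
  assumes "g summable_on A" "\<And>x. x \<in> A \<Longrightarrow> \<bar>f x\<bar> \<le> g x"
  shows "\<bar>infsum f A\<bar> \<le> infsum g A"
  using norm_infsum_le[OF has_sum_infsum[OF summable_on_real_comparison[OF assms]] has_sum_infsum[OF assms(1)]]
    assms(2) by simp

lemma has_sum_times:
  fixes f :: "'a \<Rightarrow> real" and g :: "'b \<Rightarrow> real"
  assumes "f summable_on A" "g summable_on B"
  shows "((\<lambda>(a, b). f a * g b) has_sum infsum f A * infsum g B) (A \<times> B)"
proof (rule has_sum_SigmaI)
  show "(\<lambda>(a, b). f a * g b) summable_on A \<times> B"
  proof -
    have "(\<lambda>p. \<bar>case p of (a, b) \<Rightarrow> f a * g b\<bar>) summable_on A \<times> B"
    proof (rule summable_on_SigmaI)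
      fix a
      have "((\<lambda>b. \<bar>f a\<bar> * \<bar>g b\<bar>) has_sum \<bar>f a\<bar> * (\<Sum>\<^sub>\<infinity>b\<in>B. \<bar>g b\<bar>)) B"
        using assms abs_summable_on_real by (intro has_sum_cmult_right has_sum_infsum) blast
      then show "((\<lambda>b. \<bar>case (a, b) of (a, b) \<Rightarrow> f a * g b\<bar>) has_sum \<bar>f a\<bar> * (\<Sum>\<^sub>\<infinity>b\<in>B. \<bar>g b\<bar>)) B"
        by (simp add: abs_mult)
    next
      show "(\<lambda>a. \<bar>f a\<bar> * (\<Sum>\<^sub>\<infinity>b\<in>B. \<bar>g b\<bar>)) summable_on A"
        using assms abs_summable_on_real by (intro summable_on_cmult_left) blast
    qed simp
    then show ?thesis by (simp add: abs_summable_on_real)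
  qed
  show "((\<lambda>b. case (a, b) of (a, b) \<Rightarrow> f a * g b) has_sum f a * infsum g B) B" for a
    using assms by (auto intro: has_sum_cmult_right)
  show "((\<lambda>a. f a * infsum g B) has_sum infsum f A * infsum g B) A"
    using assms by (auto intro: has_sum_cmult_left)
qed

lemmas summable_on_times = has_sum_imp_summable[OF has_sum_times]
lemmas infsum_times = infsumI[OF has_sum_times]

section \<open>The spaces of absolutely summable and of weighted square summable sequences\<close>

definition ell1 :: "(nat \<Rightarrow> real) set" where
  "ell1 = {x. x 0 = 0 \<and> x summable_on UNIV}"

definition l1norm :: "(nat \<Rightarrow> real) \<Rightarrow> real" where
  "l1norm x = (\<Sum>\<^sub>\<infinity>l. \<bar>x l\<bar>)"

lemma ell1_abs: "x \<in> ell1 \<Longrightarrow> (\<lambda>l. \<bar>x l\<bar>) summable_on UNIV"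
  by (simp add: ell1_def abs_summable_on_real)

lemma sum_le_l1norm: "x \<in> ell1 \<Longrightarrow> finite F \<Longrightarrow> (\<Sum>l\<in>F. \<bar>x l\<bar>) \<le> l1norm x"
  unfolding l1norm_def by (rule finite_sum_le_infsum) (auto simp: ell1_abs)

lemma component_le_l1norm: "x \<in> ell1 \<Longrightarrow> \<bar>x l\<bar> \<le> l1norm x"
  using sum_le_l1norm[of x "{l}"] by simp

lemma l1norm_nonneg: "0 \<le> l1norm x"
  by (simp add: l1norm_def infsum_nonneg)

lemma ell1_diff: "x \<in> ell1 \<Longrightarrow> y \<in> ell1 \<Longrightarrow> (\<lambda>l. x l - y l) \<in> ell1"
  unfolding ell1_def using summable_on_add[of x UNIV "\<lambda>l. - y l"] by (auto simp: summable_on_uminus)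

lemma ell1_of_finite_bound:
  assumes "x 0 = 0" "\<And>F. finite F \<Longrightarrow> 0 \<notin> F \<Longrightarrow> (\<Sum>l\<in>F. \<bar>x l\<bar>) \<le> B"
  shows "x \<in> ell1" "l1norm x \<le> B"
proof -
  have *: "(\<Sum>l\<in>F. \<bar>x l\<bar>) \<le> B" if "finite F" for F
  proof -
    have "(\<Sum>l\<in>F. \<bar>x l\<bar>) = (\<Sum>l\<in>F - {0}. \<bar>x l\<bar>)"
      by (rule sum.mono_neutral_right) (use that assms in auto)
    also have "\<dots> \<le> B" using that by (intro assms) auto
    finally show ?thesis .
  qed
  show "x \<in> ell1"
    using summable_on_of_finite_bound(1)[of UNIV "\<lambda>l. \<bar>x l\<bar>" B] * assms(1)
    by (simp add: ell1_def abs_summable_on_real)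
  show "l1norm x \<le> B"
    unfolding l1norm_def by (rule summable_on_of_finite_bound(2)) (use * in auto)
qed

text \<open>
  Bounds the norm of the embedding of the weighted space into \<open>ell1\<close>, by the inequality of Cauchy and Schwarz
  with the weights \<open>1 / (1 + l\<^sup>2)\<close>.
\<close>
definition embedding_const :: real where
  "embedding_const = sqrt (\<Sum>l. 1 / (1 + (real l)\<^sup>2))"

lemma summable_weights: "summable (\<lambda>l. 1 / (1 + (real l)\<^sup>2))"
proof (rule summable_comparison_test')
  show "summable (\<lambda>l. 1 / (real l)\<^sup>2)"
    using inverse_power_summable[of 2, where 'a=real] by (simp add: divide_inverse)
  show "norm (1 / (1 + (real l)\<^sup>2)) \<le> 1 / (real l)\<^sup>2" if "l \<ge> 1" for l
    using that by (auto simp: frac_le)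
qed

lemma embedding_const_pos: "0 < embedding_const"
proof -
  have "1 / (1 + (real 0)\<^sup>2) \<le> (\<Sum>l. 1 / (1 + (real l)\<^sup>2))"
    using sum_le_suminf[OF summable_weights, of "{0}"] by simp
  then show ?thesis by (simp add: embedding_const_def)
qed

lemma wnorm_nonneg: "x \<in> ell2w \<Longrightarrow> 0 \<le> wnorm x"
  by (auto simp: wnorm_def ell2w_def suminf_nonneg)

lemma ell2w_imp_ell1:
  assumes "x \<in> ell2w"
  shows "x \<in> ell1" "l1norm x \<le> embedding_const * wnorm x"
proof -
  have sm: "summable (\<lambda>l. (1 + (real l)\<^sup>2) * (x l)\<^sup>2)" and x0: "x 0 = 0"
    using assms by (auto simp: ell2w_def)
  have "(\<Sum>l\<in>F. \<bar>x l\<bar>) \<le> embedding_const * wnorm x" if F: "finite F" for F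
  proof -
    have eq: "\<bar>x l\<bar> = (1 / sqrt (1 + (real l)\<^sup>2)) * (sqrt (1 + (real l)\<^sup>2) * \<bar>x l\<bar>)" for l
      by (simp add: add_nonneg_eq_0_iff)
    have "(\<Sum>l\<in>F. \<bar>x l\<bar>)\<^sup>2 \<le> (\<Sum>l\<in>F. (1 / sqrt (1 + (real l)\<^sup>2))\<^sup>2) * (\<Sum>l\<in>F. (sqrt (1 + (real l)\<^sup>2) * \<bar>x l\<bar>)\<^sup>2)"
      using Cauchy_Schwarz_ineq_sum[of "\<lambda>l. 1 / sqrt (1 + (real l)\<^sup>2)" "\<lambda>l. sqrt (1 + (real l)\<^sup>2) * \<bar>x l\<bar>" F]
      by (simp only: eq[symmetric])
    also have "\<dots> = (\<Sum>l\<in>F. 1 / (1 + (real l)\<^sup>2)) * (\<Sum>l\<in>F. (1 + (real l)\<^sup>2) * (x l)\<^sup>2)"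
      by (simp add: power_mult_distrib power_divide)
    also have "\<dots> \<le> (\<Sum>l. 1 / (1 + (real l)\<^sup>2)) * (\<Sum>l. (1 + (real l)\<^sup>2) * (x l)\<^sup>2)"
      using F by (intro mult_mono sum_le_suminf summable_weights sm suminf_nonneg sum_nonneg) auto
    finally have "(\<Sum>l\<in>F. \<bar>x l\<bar>) \<le> sqrt ((\<Sum>l. 1 / (1 + (real l)\<^sup>2)) * (\<Sum>l. (1 + (real l)\<^sup>2) * (x l)\<^sup>2))"
      by (rule real_le_rsqrt)
    then show ?thesis by (simp add: embedding_const_def wnorm_def real_sqrt_mult)
  qed
  then show "x \<in> ell1" "l1norm x \<le> embedding_const * wnorm x"
    using ell1_of_finite_bound[of x, OF x0] by blast+
qed

text \<open>
  The converse estimate: \<open>1 + l\<^sup>2 \<le> 4 * l\<^sup>2\<close> for \<open>l \<ge> 1\<close>, and an \<open>\<ell>\<^sup>2\<close> norm is at most the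
  corresponding \<open>\<ell>\<^sup>1\<close> norm. Only finite sums have to be bounded.
\<close>
lemma ell2w_of_weighted_sum:
  assumes x0: "x 0 = 0" and B: "\<And>F. finite F \<Longrightarrow> (\<Sum>l\<in>F. real l * \<bar>x l\<bar>) \<le> B"
  shows "x \<in> ell2w" "wnorm x \<le> 2 * B"
proof -
  have B0: "0 \<le> B" using B[of "{}"] by simp
  have le: "(\<Sum>l\<in>F. (1 + (real l)\<^sup>2) * (x l)\<^sup>2) \<le> (2 * B)\<^sup>2" if F: "finite F" for F
  proof -
    have "(\<Sum>l\<in>F. (1 + (real l)\<^sup>2) * (x l)\<^sup>2) \<le> (\<Sum>l\<in>F. 4 * (real l * \<bar>x l\<bar>)\<^sup>2)"
    proof (rule sum_mono)
      fix l
      show "(1 + (real l)\<^sup>2) * (x l)\<^sup>2 \<le> 4 * (real l * \<bar>x l\<bar>)\<^sup>2"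
      proof (cases "l = 0")
        case False
        then have "1 \<le> (real l)\<^sup>2" by simp
        then have "1 + (real l)\<^sup>2 \<le> 4 * (real l)\<^sup>2" by linarith
        from mult_right_mono[OF this, of "(x l)\<^sup>2"] show ?thesis
          by (simp add: power_mult_distrib mult.assoc)
      qed (simp add: x0)
    qed
    also have "\<dots> = 4 * (L2_set (\<lambda>l. real l * \<bar>x l\<bar>) F)\<^sup>2"
      by (simp add: L2_set_def sum_nonneg sum_distrib_left)
    also have "\<dots> \<le> 4 * B\<^sup>2"
      using L2_set_le_sum[of F "\<lambda>l. real l * \<bar>x l\<bar>"] B[OF F]
      by (intro mult_left_mono power_mono) auto
    finally show ?thesis by (simp add: power_mult_distrib)
  qed
  have sm: "summable (\<lambda>l. (1 + (real l)\<^sup>2) * (x l)\<^sup>2)"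
    using le by (intro bounded_imp_summable[of _ "(2 * B)\<^sup>2"]) auto
  then show "x \<in> ell2w" by (simp add: ell2w_def x0)
  have "(\<Sum>l. (1 + (real l)\<^sup>2) * (x l)\<^sup>2) \<le> (2 * B)\<^sup>2"
    using le by (intro suminf_le_const sm) auto
  then show "wnorm x \<le> 2 * B"
    unfolding wnorm_def using B0 by (intro real_le_lsqrt) auto
qed

lemma ell2w_diff:
  assumes "x \<in> ell2w" "y \<in> ell2w"
  shows "(\<lambda>l. x l - y l) \<in> ell2w"
proof -
  have "summable (\<lambda>l. 2 * ((1 + (real l)\<^sup>2) * (x l)\<^sup>2) + 2 * ((1 + (real l)\<^sup>2) * (y l)\<^sup>2))"
    using assms by (intro summable_add summable_mult) (auto simp: ell2w_def)
  then have "summable (\<lambda>l. (1 + (real l)\<^sup>2) * (x l - y l)\<^sup>2)"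
  proof (rule summable_comparison_test'[where N=0])
    fix l
    have "(x l - y l)\<^sup>2 \<le> 2 * (x l)\<^sup>2 + 2 * (y l)\<^sup>2"
      using sum_squares_bound[of "x l" "- y l"] by (simp add: power2_eq_square algebra_simps)
    from mult_left_mono[OF this, of "1 + (real l)\<^sup>2"]
    show "norm ((1 + (real l)\<^sup>2) * (x l - y l)\<^sup>2)
        \<le> 2 * ((1 + (real l)\<^sup>2) * (x l)\<^sup>2) + 2 * ((1 + (real l)\<^sup>2) * (y l)\<^sup>2)"
      by (simp add: algebra_simps)
  qed
  then show ?thesis using assms by (simp add: ell2w_def)
qed

lemma unit_seq_ell2w: "k \<ge> 1 \<Longrightarrow> (\<lambda>l. s * unit_seq k l) \<in> ell2w"
  by (auto simp: ell2w_def unit_seq_def split: if_splits intro!: summable_finite[of "{k}"])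

lemma component_le_wnorm:
  assumes "x \<in> ell2w"
  shows "\<bar>x l\<bar> \<le> embedding_const * wnorm x"
  using component_le_l1norm[OF ell2w_imp_ell1(1)[OF assms], of l] ell2w_imp_ell1(2)[OF assms] by simp

text \<open>
  Translates neighbourhoods of a bifurcation point \<open>(0, 2 / A)\<close> in the weighted space into
  neighbourhoods for the \<open>\<ell>\<^sup>1\<close> norm and the parameter \<open>2 / k\<close>.
\<close>
lemma ell2w_nhd_imp_ell1_nhd:
  fixes A \<epsilon> :: real
  assumes A: "A > 0" and \<epsilon>: "\<epsilon> > 0"
  obtains \<epsilon>' where "\<epsilon>' > 0"
    "\<And>x. x \<in> ell2w \<Longrightarrow> wnorm x < \<epsilon>' \<Longrightarrow> l1norm x < \<epsilon>"
    "\<And>k. \<bar>k - 2 / A\<bar> < \<epsilon>' \<Longrightarrow> \<bar>2 / k - A\<bar> < \<epsilon>"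
proof -
  have "isCont (\<lambda>k. 2 / k) (2 / A)" using A by (intro continuous_intros) auto
  then obtain d where d: "d > 0" "\<And>k. dist k (2 / A) < d \<Longrightarrow> dist (2 / k) (2 / (2 / A)) < \<epsilon>"
    using \<epsilon> by (auto simp: continuous_at_eps_delta)
  show ?thesis
  proof (rule that[of "min d (\<epsilon> / embedding_const)"])
    show "0 < min d (\<epsilon> / embedding_const)" using d(1) \<epsilon> embedding_const_pos by simp
    show "\<bar>2 / k - A\<bar> < \<epsilon>" if "\<bar>k - 2 / A\<bar> < min d (\<epsilon> / embedding_const)" for k
      using d(2)[of k] that by (simp add: dist_real_def)
    show "l1norm x < \<epsilon>" if "x \<in> ell2w" "wnorm x < min d (\<epsilon> / embedding_const)" for x
      using ell2w_imp_ell1(2)[OF that(1)] that(2) embedding_const_pos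
      by (simp add: field_simps)
  qed
qed

section \<open>The quadratic part of the equations\<close>

text \<open>
  The coefficient of \<open>x j * x k\<close> in the \<open>l\<close>-th equation. The finite sum over \<open>j < l\<close> contributes the
  pairs with \<open>j + k = l\<close>, the infinite sum over \<open>j > l\<close> those with \<open>j = k + l\<close>. For \<open>l \<ge> 1\<close> both
  conditions hold only if \<open>k = 0\<close>, where the sequences vanish.
\<close>
definition coupling :: "(nat \<Rightarrow> real) \<Rightarrow> nat \<Rightarrow> nat \<Rightarrow> nat \<Rightarrow> real" where
  "coupling a l j k = (if j + k = l then real j * a j
                       else if j = k + l then real j * a j - real k * a k else 0)"

definition quad :: "(nat \<Rightarrow> real) \<Rightarrow> nat \<Rightarrow> (nat \<Rightarrow> real) \<Rightarrow> (nat \<Rightarrow> real) \<Rightarrow> real" where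
  "quad a l x y = (\<Sum>\<^sub>\<infinity>(j, k). coupling a l j k * x j * y k)"

locale bounded_coeffs =
  fixes a :: "nat \<Rightarrow> real" and C :: real
  assumes coeff_bound: "\<And>l. real l * \<bar>a l\<bar> \<le> C" and C_pos: "0 < C"
begin

text \<open>
  For fixed \<open>(j, k)\<close> only \<open>l = j + k\<close> and \<open>l = j - k\<close> contribute, with at most \<open>C\<close> and
  \<open>2 * C\<close>. The case \<open>j < k\<close>, in which the truncated difference is \<open>0\<close>, is covered since the
  coefficient then vanishes unless \<open>l = j + k\<close>.
\<close>
lemma coupling_bound:
  assumes "finite F"
  shows "(\<Sum>l\<in>F. \<bar>coupling a l j k\<bar>) \<le> 3 * C"
proof -
  have c: "\<bar>real i * a i\<bar> \<le> C" for i using coeff_bound[of i] by (simp add: abs_mult)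
  have "(\<Sum>l\<in>F. \<bar>coupling a l j k\<bar>)
      \<le> (\<Sum>l\<in>F. (if l = j + k then C else 0) + (if l = j - k then 2 * C else 0))"
  proof (rule sum_mono)
    fix l
    show "\<bar>coupling a l j k\<bar> \<le> (if l = j + k then C else 0) + (if l = j - k then 2 * C else 0)"
      using c[of j] c[of k] C_pos by (auto simp: coupling_def)
  qed
  also have "\<dots> = (if j + k \<in> F then C else 0) + (if j - k \<in> F then 2 * C else 0)"
    using assms by (simp add: sum.distrib)
  also have "\<dots> \<le> 3 * C" using C_pos by auto
  finally show ?thesis .
qed

lemma abs_coupling_le: "\<bar>coupling a l j k\<bar> \<le> 3 * C"
  using coupling_bound[of "{l}"] by simp

lemma quad_terms_summable:
  assumes "x \<in> ell1" "y \<in> ell1"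
  shows "(\<lambda>(j, k). coupling a l j k * x j * y k) summable_on UNIV"
proof (rule summable_on_real_comparison)
  show "(\<lambda>(j, k). 3 * C * (\<bar>x j\<bar> * \<bar>y k\<bar>)) summable_on UNIV"
    using summable_on_cmult_right[OF summable_on_times[OF assms[THEN ell1_abs]], of "3 * C"]
    by (simp add: case_prod_unfold)
  show "\<bar>case p of (j, k) \<Rightarrow> coupling a l j k * x j * y k\<bar> \<le> (case p of (j, k) \<Rightarrow> 3 * C * (\<bar>x j\<bar> * \<bar>y k\<bar>))"
    for p
  proof (cases p)
    case (Pair j k)
    show ?thesis
      using mult_right_mono[OF abs_coupling_le[of l j k], of "\<bar>x j\<bar> * \<bar>y k\<bar>"]
      by (simp add: Pair abs_mult mult.assoc)
  qed
qed

text \<open>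
  Summing over \<open>l\<close> first, the coupling costs a constant, and the sum over \<open>(j, k)\<close>
  factorizes. This is the estimate on which everything rests: it loses no power of \<open>l\<close>, so the
  factor \<open>l\<close> of the linear part is gained back in full.
\<close>
lemma quad_bound:
  assumes x: "x \<in> ell1" and y: "y \<in> ell1" and F: "finite F"
  shows "(\<Sum>l\<in>F. \<bar>quad a l x y\<bar>) \<le> 3 * C * l1norm x * l1norm y"
proof -
  define t where "t l p = \<bar>case p of (j, k) \<Rightarrow> coupling a l j k * x j * y k\<bar>" for l p
  have t: "t l summable_on UNIV" for l
    unfolding t_def using quad_terms_summable[OF x y] by (simp only: abs_summable_on_real)
  have xy: "((\<lambda>(j, k). 3 * C * (\<bar>x j\<bar> * \<bar>y k\<bar>)) has_sum 3 * C * (l1norm x * l1norm y)) UNIV"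
    using has_sum_cmult_right[OF has_sum_times[OF ell1_abs[OF x] ell1_abs[OF y]], of "3 * C"]
    by (simp add: case_prod_unfold l1norm_def)
  have has_sum_F: "((\<lambda>p. \<Sum>l\<in>F. t l p) has_sum (\<Sum>l\<in>F. infsum (t l) UNIV)) UNIV"
    using F by induction (auto intro!: has_sum_add has_sum_infsum t)
  have "(\<Sum>l\<in>F. \<bar>quad a l x y\<bar>) \<le> (\<Sum>l\<in>F. infsum (t l) UNIV)"
    unfolding quad_def by (intro sum_mono abs_infsum_le t) (auto simp: t_def)
  also have "\<dots> = (\<Sum>\<^sub>\<infinity>p. \<Sum>l\<in>F. t l p)"
    by (rule infsumI[OF has_sum_F, symmetric])
  also have "\<dots> \<le> (\<Sum>\<^sub>\<infinity>(j, k). 3 * C * (\<bar>x j\<bar> * \<bar>y k\<bar>))"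
  proof (rule infsum_mono)
    show "(\<lambda>p. \<Sum>l\<in>F. t l p) summable_on UNIV"
      using has_sum_F by (rule has_sum_imp_summable)
    show "(\<lambda>(j, k). 3 * C * (\<bar>x j\<bar> * \<bar>y k\<bar>)) summable_on UNIV"
      using xy by (rule has_sum_imp_summable)
    show "(\<Sum>l\<in>F. t l p) \<le> (case p of (j, k) \<Rightarrow> 3 * C * (\<bar>x j\<bar> * \<bar>y k\<bar>))" for p
    proof (cases p)
      case (Pair j k)
      have "(\<Sum>l\<in>F. t l p) = (\<Sum>l\<in>F. \<bar>coupling a l j k\<bar>) * (\<bar>x j\<bar> * \<bar>y k\<bar>)"
        by (simp add: Pair t_def abs_mult mult.assoc sum_distrib_right)
      then show ?thesis
        using mult_right_mono[OF coupling_bound[OF F, of j k], of "\<bar>x j\<bar> * \<bar>y k\<bar>"] Pair by simp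
    qed
  qed
  also have "\<dots> = 3 * C * (l1norm x * l1norm y)" by (rule infsumI[OF xy])
  finally show ?thesis by (simp add: mult.assoc)
qed

lemma abs_quad_le:
  "x \<in> ell1 \<Longrightarrow> y \<in> ell1 \<Longrightarrow> \<bar>quad a l x y\<bar> \<le> 3 * C * l1norm x * l1norm y"
  using quad_bound[of x y "{l}"] by simp

lemma quad_diff:
  assumes "x \<in> ell1" "y \<in> ell1"
  shows "quad a l x x - quad a l y y
       = quad a l x (\<lambda>i. x i - y i) + quad a l (\<lambda>i. x i - y i) y"
proof -
  have split: "infsum f UNIV = infsum g UNIV + infsum h UNIV"
    if "g summable_on UNIV" "h summable_on UNIV" "\<And>p. f p = g p + h p"
    for f g h :: "nat \<times> nat \<Rightarrow> real"
    using infsum_add[OF that(1,2)] unfolding that(3)[symmetric] .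
  note s = quad_terms_summable
  have 1: "quad a l x x = quad a l x (\<lambda>i. x i - y i) + quad a l x y"
    unfolding quad_def
    by (rule split[OF s[OF assms(1) ell1_diff[OF assms]] s[OF assms]]) (auto simp: algebra_simps)
  have 2: "quad a l x y = quad a l (\<lambda>i. x i - y i) y + quad a l y y"
    unfolding quad_def
    by (rule split[OF s[OF ell1_diff[OF assms] assms(2)] s[OF assms(2) assms(2)]])
      (auto simp: algebra_simps)
  show ?thesis using 1 2 by simp
qed

lemma MV_map_eq_quad:
  assumes x: "x \<in> ell1" and l: "l \<ge> 1"
  shows "MV_map a x \<kappa> l = real l * (2 - \<kappa> * a l) * x l - \<kappa> * quad a l x x"
proof -
  define t where "t = (\<lambda>(j, k). coupling a l j k * x j * x k)"
  have x0: "x 0 = 0" using x by (simp add: ell1_def)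
  have ts: "t summable_on A" for A
    using summable_on_subset_banach[OF quad_terms_summable[OF x x]] by (simp add: t_def)
  define P where "P = (\<lambda>j. (j, l - j)) ` {1..<l}"
  define R where "R = (\<lambda>j. (j, j - l)) ` {l<..}"
  have "quad a l x x = infsum t (P \<union> R)"
    unfolding quad_def t_def[symmetric]
  proof (rule infsum_cong_neutral)
    fix p assume p: "p \<in> UNIV - (P \<union> R)"
    obtain j k where jk: "p = (j, k)" by (cases p)
    have "x j = 0 \<or> x k = 0 \<or> coupling a l j k = 0"
    proof (rule ccontr)
      assume "\<not> ?thesis"
      then have "j > 0" "k > 0" "coupling a l j k \<noteq> 0" using x0 by (auto intro!: gr0I)
      then have "p \<in> P \<union> R"
        by (force simp: jk coupling_def P_def R_def image_iff split: if_splits)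
      then show False using p by simp
    qed
    then show "t p = 0" by (auto simp: t_def jk)
  qed auto
  also have "\<dots> = infsum t P + infsum t R"
    by (rule infsum_Un_disjoint[OF ts ts]) (auto simp: P_def R_def)
  also have "infsum t P = (\<Sum>j\<in>{1..<l}. real j * a j * x j * x (l - j))"
    unfolding P_def by (subst infsum_reindex) (auto simp: inj_on_def t_def coupling_def intro!: sum.cong)
  also have "infsum t R = (\<Sum>\<^sub>\<infinity>j\<in>{l<..}. (real j * a j - real (j - l) * a (j - l)) * x j * x (j - l))"
    unfolding R_def by (subst infsum_reindex) (use l in \<open>auto simp: inj_on_def t_def coupling_def intro!: infsum_cong\<close>)
  finally show ?thesis by (simp add: MV_map_def algebra_simps)
qed

text \<open>
  Dividing by \<open>\<kappa>\<close> makes the equations affine in the parameter \<open>2 / \<kappa>\<close> and moves the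
  parameter out of the quadratic part.
\<close>
lemma MV_zero_iff:
  assumes "x \<in> ell1" "\<kappa> > 0"
  shows "MV_zero a x \<kappa> \<longleftrightarrow> (\<forall>l\<ge>1. real l * (2 / \<kappa> - a l) * x l = quad a l x x)"
proof -
  have "MV_map a x \<kappa> l = \<kappa> * (real l * (2 / \<kappa> - a l) * x l - quad a l x x)" if "l \<ge> 1" for l
    using assms that by (simp add: MV_map_eq_quad field_simps)
  then show ?thesis using assms by (auto simp: MV_zero_def)
qed

end

section \<open>Periodicity of small zeros\<close>

context bounded_coeffs begin

text \<open>
  Since \<open>\<bar>a l\<bar> \<le> C / l\<close>, all but finitely many \<open>a l\<close> are at most half of \<open>a m\<close>; among
  the remaining ones, those that differ from \<open>a m\<close> have a positive distance to it.
\<close>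
lemma spectral_gap:
  assumes "a m > 0"
  obtains c where "c > 0" "\<And>l. l \<ge> 1 \<Longrightarrow> a l \<noteq> a m \<Longrightarrow> c \<le> \<bar>a m - a l\<bar>"
proof -
  obtain L :: nat where L: "2 * C / a m < real L" using reals_Archimedean2 by blast
  define c where "c = Min (insert (a m / 2) ((\<lambda>l. \<bar>a m - a l\<bar>) ` {l. l \<le> L \<and> a l \<noteq> a m}))"
  have fin: "finite (insert (a m / 2) ((\<lambda>l. \<bar>a m - a l\<bar>) ` {l. l \<le> L \<and> a l \<noteq> a m}))" by simp
  show ?thesis
  proof (rule that)
    show "c > 0" unfolding c_def using assms by (subst Min_gr_iff[OF fin]) auto
    fix l assume l: "l \<ge> 1" "a l \<noteq> a m"
    show "c \<le> \<bar>a m - a l\<bar>"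
    proof (cases "l \<le> L")
      case True
      then show ?thesis unfolding c_def using l by (intro Min_le[OF fin]) auto
    next
      case False
      have "\<bar>a l\<bar> \<le> a m / 2"
      proof (rule ccontr)
        assume "\<not> ?thesis"
        then have "real L * (a m / 2) \<le> real l * \<bar>a l\<bar>" using False assms by (intro mult_mono) auto
        also have "\<dots> \<le> C" by (rule coeff_bound)
        finally show False using L assms by (simp add: field_simps)
      qed
      moreover have "c \<le> a m / 2" unfolding c_def by (intro Min_le[OF fin]) auto
      ultimately show ?thesis using assms by linarith
    qed
  qed
qed

text \<open>
  The multiples of \<open>g\<close> are closed under sums and differences, so they never excite another mode.
\<close>
lemma quad_periodic_eq_0:
  assumes "\<And>j. \<not> g dvd j \<Longrightarrow> x j = 0" "\<not> g dvd l"
  shows "quad a l x x = 0"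
proof -
  have "coupling a l j k * x j * x k = 0" for j k
  proof (cases "g dvd j \<and> g dvd k")
    case True
    then have "j + k \<noteq> l" "j \<noteq> k + l"
      using assms(2) dvd_add[of g j k] dvd_add_right_iff[of g k l] by auto
    then show ?thesis by (simp add: coupling_def)
  qed (use assms in auto)
  then have "(\<lambda>(j, k). coupling a l j k * x j * x k) = (\<lambda>_. 0)" by (auto simp only: split: prod.split)
  then show ?thesis by (simp add: quad_def)
qed

text \<open>
  Split a zero \<open>x = w + z\<close> into its modes divisible by \<open>g\<close> and the rest. At a mode that \<open>g\<close> does
  not divide, the interaction of \<open>w\<close> with itself drops out, and the gap yields
  \<open>\<parallel>z\<parallel> \<le> const * \<parallel>x\<parallel> * \<parallel>z\<parallel>\<close> with \<open>const * \<parallel>x\<parallel> \<le> 1 / 2\<close>.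
\<close>
lemma small_zero_periodic_ell1:
  assumes m: "a m > 0" and S: "\<And>l. l \<ge> 1 \<Longrightarrow> a l = a m \<Longrightarrow> g dvd l"
  obtains \<epsilon> where "\<epsilon> > 0"
    "\<And>x k. x \<in> ell1 \<Longrightarrow> k > 0 \<Longrightarrow> MV_zero a x k \<Longrightarrow> l1norm x < \<epsilon> \<Longrightarrow> \<bar>2 / k - a m\<bar> < \<epsilon>
       \<Longrightarrow> mode_periodic g x"
proof -
  obtain c where c: "c > 0" "\<And>l. l \<ge> 1 \<Longrightarrow> a l \<noteq> a m \<Longrightarrow> c \<le> \<bar>a m - a l\<bar>"
    using spectral_gap[of m] m by blast
  \<comment> \<open>\<open>c / 2\<close> keeps half of the gap; \<open>c / (24 * C)\<close> makes \<open>6 * C * \<parallel>x\<parallel>\<close>, the constant in front of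
      \<open>\<parallel>z\<parallel>\<close> below, half of the remaining \<open>c / 2\<close>.\<close>
  define \<epsilon> where "\<epsilon> = min (c / 2) (c / (24 * C))"
  show ?thesis
  proof (rule that)
    show "\<epsilon> > 0" using c C_pos by (simp add: \<epsilon>_def)
    fix x k assume x: "x \<in> ell1" and k: "k > 0" and zero: "MV_zero a x k"
      and small: "l1norm x < \<epsilon>" "\<bar>2 / k - a m\<bar> < \<epsilon>"
    define z where "z l = (if g dvd l then 0 else x l)" for l
    define w where "w l = x l - z l" for l
    have x0: "x 0 = 0" using x by (simp add: ell1_def)
    have "(\<Sum>l\<in>F. \<bar>z l\<bar>) \<le> l1norm x" if "finite F" for F
      using sum_mono[of F "\<lambda>l. \<bar>z l\<bar>" "\<lambda>l. \<bar>x l\<bar>"] sum_le_l1norm[OF x that] by (force simp: z_def)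
    then have z: "z \<in> ell1" "l1norm z \<le> l1norm x"
      using ell1_of_finite_bound[of z "l1norm x"] x0 by (auto simp: z_def)
    have "(\<Sum>l\<in>F. \<bar>w l\<bar>) \<le> l1norm x" if "finite F" for F
      using sum_mono[of F "\<lambda>l. \<bar>w l\<bar>" "\<lambda>l. \<bar>x l\<bar>"] sum_le_l1norm[OF x that]
      by (force simp: z_def w_def)
    then have w: "w \<in> ell1" "l1norm w \<le> l1norm x"
      using ell1_of_finite_bound[of w "l1norm x"] x0 by (auto simp: z_def w_def)
    have pointwise: "c / 2 * \<bar>z l\<bar> \<le> \<bar>quad a l x z\<bar> + \<bar>quad a l z w\<bar>" if l: "l \<ge> 1" for l
    proof (cases "g dvd l")
      case False
      have "c / 2 \<le> \<bar>2 / k - a l\<bar>"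
      proof -
        have "c \<le> \<bar>a m - a l\<bar>" using c(2)[OF l] S[OF l] False by auto
        then show ?thesis
          using small(2) abs_triangle_ineq2[of "a m - a l" "a m - 2 / k"]
          by (auto simp: \<epsilon>_def abs_minus_commute)
      qed
      moreover have "1 \<le> real l" using l by simp
      ultimately have "1 * (c / 2) \<le> real l * \<bar>2 / k - a l\<bar>" using c(1) by (intro mult_mono) auto
      then have "c / 2 * \<bar>x l\<bar> \<le> real l * \<bar>2 / k - a l\<bar> * \<bar>x l\<bar>" by (intro mult_right_mono) auto
      also have "\<dots> = \<bar>quad a l x x\<bar>"
      proof -
        have "real l * (2 / k - a l) * x l = quad a l x x"
          using zero l by (simp add: MV_zero_iff[OF x k])
        then show ?thesis by (metis abs_mult abs_of_nat)
      qed
      also have "quad a l x x = quad a l x x - quad a l w w"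
        using quad_periodic_eq_0[of g w l] False by (simp add: w_def z_def)
      also have "\<dots> = quad a l x z + quad a l z w"
        using quad_diff[OF x w(1), of l] by (simp add: w_def)
      finally have "c / 2 * \<bar>x l\<bar> \<le> \<bar>quad a l x z + quad a l z w\<bar>" .
      then show ?thesis
        using False abs_triangle_ineq[of "quad a l x z" "quad a l z w"] by (simp add: z_def)
    qed (simp add: z_def)
    have "(\<Sum>l\<in>F. \<bar>z l\<bar>) \<le> l1norm z / 2" if F: "finite F" "0 \<notin> F" for F
    proof -
      have "c / 2 * (\<Sum>l\<in>F. \<bar>z l\<bar>) \<le> (\<Sum>l\<in>F. \<bar>quad a l x z\<bar>) + (\<Sum>l\<in>F. \<bar>quad a l z w\<bar>)"
        unfolding sum_distrib_left sum.distrib[symmetric]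
        using F by (intro sum_mono pointwise) (auto simp: Suc_le_eq intro!: gr0I)
      also have "\<dots> \<le> 3 * C * l1norm x * l1norm z + 3 * C * l1norm z * l1norm w"
        using F by (intro add_mono quad_bound x z w)
      also have "\<dots> \<le> 3 * C * l1norm x * l1norm z + 3 * C * l1norm z * l1norm x"
        using C_pos w(2) by (intro add_left_mono mult_left_mono) (auto simp: l1norm_nonneg)
      also have "\<dots> = (6 * C * l1norm x) * l1norm z" by simp
      also have "\<dots> \<le> (c / 4) * l1norm z"
        using small(1) C_pos by (intro mult_right_mono l1norm_nonneg) (simp add: \<epsilon>_def field_simps)
      finally show ?thesis using c(1) by (simp add: field_simps)
    qed
    then have "l1norm z \<le> l1norm z / 2"
      using ell1_of_finite_bound(2)[of z "l1norm z / 2"] by (simp add: z_def)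
    then have "z l = 0" for l using component_le_l1norm[OF z(1), of l] by simp
    then show "mode_periodic g x" unfolding mode_periodic_def z_def by metis
  qed
qed

lemma small_zero_periodic:
  assumes m: "a m > 0" and S: "\<And>l. l \<ge> 1 \<Longrightarrow> a l = a m \<Longrightarrow> g dvd l"
  obtains \<epsilon> where "\<epsilon> > 0"
    "\<And>x k. x \<in> ell2w \<Longrightarrow> k > 0 \<Longrightarrow> MV_zero a x k \<Longrightarrow> wnorm x < \<epsilon> \<Longrightarrow> \<bar>k - 2 / a m\<bar> < \<epsilon>
       \<Longrightarrow> mode_periodic g x"
proof -
  obtain \<epsilon> where \<epsilon>: "\<epsilon> > 0" "\<And>x k. x \<in> ell1 \<Longrightarrow> k > 0 \<Longrightarrow> MV_zero a x k \<Longrightarrow> l1norm x < \<epsilon>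
       \<Longrightarrow> \<bar>2 / k - a m\<bar> < \<epsilon> \<Longrightarrow> mode_periodic g x"
    using small_zero_periodic_ell1[OF m S] by blast
  obtain \<epsilon>' where "\<epsilon>' > 0" "\<And>x. x \<in> ell2w \<Longrightarrow> wnorm x < \<epsilon>' \<Longrightarrow> l1norm x < \<epsilon>"
    "\<And>k. \<bar>k - 2 / a m\<bar> < \<epsilon>' \<Longrightarrow> \<bar>2 / k - a m\<bar> < \<epsilon>"
    using ell2w_nhd_imp_ell1_nhd[OF m \<epsilon>(1)] by blast
  then show ?thesis using \<epsilon> ell2w_imp_ell1(1) that[of \<epsilon>'] by blast
qed

text \<open>
  By continuity the branch stays in the neighbourhood of \<open>small_zero_periodic\<close> for small
  parameters.
\<close>
lemma branch_mode_periodic: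
  assumes m: "a m > 0" and S: "\<And>l. l \<ge> 1 \<Longrightarrow> a l = a m \<Longrightarrow> g dvd l"
    and branch: "nontrivial_branch a (2 / a m) \<delta> p \<kappa>"
  shows "\<exists>\<delta>'\<in>{0<..\<delta>}. \<forall>s\<in>{-\<delta>'<..<\<delta>'}. mode_periodic g (p s)"
proof -
  obtain \<epsilon> where \<epsilon>: "\<epsilon> > 0" "\<And>x k. x \<in> ell2w \<Longrightarrow> k > 0 \<Longrightarrow> MV_zero a x k \<Longrightarrow> wnorm x < \<epsilon>
      \<Longrightarrow> \<bar>k - 2 / a m\<bar> < \<epsilon> \<Longrightarrow> mode_periodic g x"
    using small_zero_periodic[OF m S] by blast
  have \<delta>: "0 < \<delta>" and p0: "p 0 = (\<lambda>l. 0)" and \<kappa>0: "\<kappa> 0 = 2 / a m"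
    and zero: "\<And>s. s \<in> {-\<delta><..<\<delta>} \<Longrightarrow> p s \<in> ell2w \<and> 0 < \<kappa> s \<and> MV_zero a (p s) (\<kappa> s)"
    using branch by (auto simp: nontrivial_branch_def)
  have "0 \<in> {-\<delta><..<\<delta>}" using \<delta> by simp
  then have lim: "((\<lambda>t. wnorm (\<lambda>l. p t l - p 0 l)) \<longlongrightarrow> 0) (at 0 within {-\<delta><..<\<delta>})"
    using branch unfolding nontrivial_branch_def by blast
  have at0: "at 0 within {-\<delta><..<\<delta>} = at (0::real)" using \<delta> by (intro at_within_open) auto
  have "eventually (\<lambda>t. wnorm (p t) < \<epsilon>) (at 0)"
    using order_tendstoD(2)[OF lim \<epsilon>(1)] by (simp add: p0 at0)
  moreover have "(\<kappa> \<longlongrightarrow> 2 / a m) (at 0)"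
    using branch \<open>0 \<in> {-\<delta><..<\<delta>}\<close> by (auto simp: nontrivial_branch_def continuous_on_def at0 \<kappa>0 dest!: bspec[of _ _ 0])
  then have "eventually (\<lambda>t. \<bar>\<kappa> t - 2 / a m\<bar> < \<epsilon>) (at 0)"
    using \<epsilon>(1) by (auto simp: tendsto_iff dist_real_def)
  ultimately have "eventually (\<lambda>t. wnorm (p t) < \<epsilon> \<and> \<bar>\<kappa> t - 2 / a m\<bar> < \<epsilon>) (at 0)"
    by (rule eventually_conj)
  then obtain d where d: "d > 0"
    "\<And>t. t \<noteq> 0 \<Longrightarrow> \<bar>t\<bar> < d \<Longrightarrow> wnorm (p t) < \<epsilon> \<and> \<bar>\<kappa> t - 2 / a m\<bar> < \<epsilon>"
    by (auto simp: eventually_at dist_real_def)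
  show ?thesis
  proof (intro bexI[of _ "min d \<delta>"] ballI)
    fix s assume s: "s \<in> {-min d \<delta><..<min d \<delta>}"
    show "mode_periodic g (p s)"
    proof (cases "s = 0")
      case False
      then show ?thesis using \<epsilon>(2)[of "p s" "\<kappa> s"] zero[of s] d(2)[of s] s by auto
    qed (simp add: p0 mode_periodic_def)
  qed (use d \<delta> in auto)
qed

section \<open>Uniqueness of the branch at a simple first mode\<close>

text \<open>
  The gap absorbs the linear part, so the higher modes of a zero are quadratically small.
\<close>
lemma zero_high_modes:
  assumes gap: "\<And>l. l > 1 \<Longrightarrow> c \<le> \<bar>a 1 - a l\<bar>" and c: "c > 0"
    and x: "x \<in> ell1" and k: "k > 0" and zero: "MV_zero a x k" and near: "\<bar>2 / k - a 1\<bar> \<le> c / 2"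
    and F: "finite F" "0 \<notin> F" "1 \<notin> F"
  shows "(\<Sum>l\<in>F. real l * \<bar>x l\<bar>) \<le> 6 * C / c * (l1norm x)\<^sup>2"
proof -
  have "c / 2 * (\<Sum>l\<in>F. real l * \<bar>x l\<bar>) \<le> (\<Sum>l\<in>F. \<bar>quad a l x x\<bar>)"
    unfolding sum_distrib_left
  proof (rule sum_mono)
    fix l assume "l \<in> F"
    then have l: "l > 1" using F by (metis One_nat_def Suc_lessI neq0_conv)
    have "c / 2 * (real l * \<bar>x l\<bar>) \<le> \<bar>2 / k - a l\<bar> * (real l * \<bar>x l\<bar>)"
      using gap[OF l] near abs_triangle_ineq2[of "a 1 - a l" "a 1 - 2 / k"]
      by (intro mult_right_mono) (auto simp: abs_minus_commute)
    also have "\<dots> = \<bar>real l * (2 / k - a l) * x l\<bar>" by (simp add: abs_mult)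
    also have "\<dots> = \<bar>quad a l x x\<bar>" using zero l by (simp add: MV_zero_iff[OF x k])
    finally show "c / 2 * (real l * \<bar>x l\<bar>) \<le> \<bar>quad a l x x\<bar>" .
  qed
  also have "\<dots> \<le> 3 * C * l1norm x * l1norm x" by (rule quad_bound[OF x x F(1)])
  finally show ?thesis using c by (simp add: field_simps power2_eq_square)
qed

text \<open>
  In a small ball the quadratic bound of the higher modes takes at most half of the norm; the
  first mode carries the rest. In particular a small nontrivial zero has a nonzero first mode.
\<close>
lemma zero_first_mode_dominates:
  assumes gap: "\<And>l. l > 1 \<Longrightarrow> c \<le> \<bar>a 1 - a l\<bar>" and c: "c > 0"
    and x: "x \<in> ell1" and k: "k > 0" and zero: "MV_zero a x k" and near: "\<bar>2 / k - a 1\<bar> \<le> c / 2"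
    and small: "l1norm x \<le> c / (12 * C)"
  shows "l1norm x \<le> 2 * \<bar>x 1\<bar>"
proof -
  have "(\<Sum>l\<in>F. \<bar>x l\<bar>) \<le> \<bar>x 1\<bar> + l1norm x / 2" if F: "finite F" "0 \<notin> F" for F
  proof -
    have "(\<Sum>l\<in>F. \<bar>x l\<bar>) \<le> (\<Sum>l\<in>insert 1 (F - {1}). \<bar>x l\<bar>)"
      using F by (intro sum_mono2) auto
    also have "\<dots> = \<bar>x 1\<bar> + (\<Sum>l\<in>F - {1}. \<bar>x l\<bar>)" by (rule sum.insert) (use F in auto)
    also have "(\<Sum>l\<in>F - {1}. \<bar>x l\<bar>) \<le> (\<Sum>l\<in>F - {1}. real l * \<bar>x l\<bar>)"
      using F by (intro sum_mono) (auto simp: mult_le_cancel_right1 Suc_le_eq intro!: gr0I)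
    also have "\<dots> \<le> 6 * C / c * (l1norm x)\<^sup>2"
      using F by (intro zero_high_modes[OF gap c x k zero near]) auto
    also have "\<dots> = (6 * C / c * l1norm x) * l1norm x" by (simp add: power2_eq_square)
    also have "\<dots> \<le> 1 / 2 * l1norm x"
      using small c C_pos by (intro mult_right_mono l1norm_nonneg) (simp add: field_simps)
    finally show ?thesis by simp
  qed
  then have "l1norm x \<le> \<bar>x 1\<bar> + l1norm x / 2"
    using ell1_of_finite_bound(2)[of x] x by (simp add: ell1_def)
  then show ?thesis by simp
qed

text \<open>
  Subtract the equations of the two zeros, with \<open>\<tau>\<close> the difference of the parameters and \<open>E\<close>
  the norm of \<open>d = x - y\<close>. Mode \<open>1\<close>, where \<open>d\<close> vanishes, reads \<open>\<tau> * x 1 = O(\<bar>x 1\<bar> * E)\<close> because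
  the first mode dominates; the division by \<open>x 1 \<noteq> 0\<close> bounds \<open>\<tau>\<close> by \<open>E\<close>. In the other modes every
  term on the right is then a small multiple of \<open>E\<close>, which forces \<open>E = 0\<close>. The radius
  \<open>c / (48 * C)\<close> makes the total constant \<open>c / 4\<close>, half of the \<open>c / 2\<close> that the gap leaves on the left.
\<close>
lemma zero_determined_by_first_mode:
  assumes gap: "\<And>l. l > 1 \<Longrightarrow> c \<le> \<bar>a 1 - a l\<bar>" and c: "c > 0"
    and x: "x \<in> ell1" "k > 0" "MV_zero a x k" "\<bar>2 / k - a 1\<bar> \<le> c / 2" "l1norm x \<le> c / (48 * C)"
    and y: "y \<in> ell1" "k' > 0" "MV_zero a y k'" "\<bar>2 / k' - a 1\<bar> \<le> c / 2" "l1norm y \<le> c / (48 * C)"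
    and same: "x 1 = y 1" "x 1 \<noteq> 0"
  shows "x = y" "k = k'"
proof -
  define d where "d l = x l - y l" for l
  define \<tau> where "\<tau> = 2 / k - 2 / k'"
  define E where "E = l1norm d"
  have d: "d \<in> ell1" unfolding d_def by (rule ell1_diff[OF x(1) y(1)])
  have E0: "0 \<le> E" by (simp add: E_def l1norm_nonneg)
  have weak: "c / (48 * C) \<le> c / (12 * C)" using c C_pos by (simp add: field_simps)
  have Nx: "l1norm x \<le> 2 * \<bar>x 1\<bar>" and Ny: "l1norm y \<le> 2 * \<bar>x 1\<bar>"
    using zero_first_mode_dominates[OF gap c x(1-4) order_trans[OF x(5) weak]]
      zero_first_mode_dominates[OF gap c y(1-4) order_trans[OF y(5) weak]] same by auto
  have eq: "real l * (2 / k - a l) * d l + \<tau> * (real l * y l) = quad a l x d + quad a l d y"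
    if "l \<ge> 1" for l
  proof -
    have "real l * (2 / k - a l) * x l - real l * (2 / k' - a l) * y l = quad a l x x - quad a l y y"
      using x(3) y(3) that by (simp add: MV_zero_iff[OF x(1,2)] MV_zero_iff[OF y(1,2)])
    moreover have "real l * (u - a l) * x l - real l * (v - a l) * y l
        = real l * (u - a l) * d l + (u - v) * (real l * y l)" for u v
      by (simp add: d_def algebra_simps)
    moreover have "quad a l x x - quad a l y y = quad a l x d + quad a l d y"
      unfolding d_def by (rule quad_diff[OF x(1) y(1)])
    ultimately show ?thesis by (simp add: \<tau>_def)
  qed
  have "\<bar>\<tau>\<bar> * \<bar>x 1\<bar> = \<bar>quad a 1 x d + quad a 1 d y\<bar>"
    using eq[of 1] same by (simp add: d_def abs_mult[symmetric])
  also have "\<dots> \<le> 3 * C * l1norm x * E + 3 * C * E * l1norm y"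
    using abs_quad_le[OF x(1) d, of 1] abs_quad_le[OF d y(1), of 1] by (simp add: E_def)
  also have "\<dots> = 3 * C * E * (l1norm x + l1norm y)" by (simp add: algebra_simps)
  also have "\<dots> \<le> 3 * C * E * (4 * \<bar>x 1\<bar>)"
    using Nx Ny C_pos E0 by (intro mult_left_mono) auto
  finally have \<tau>: "\<bar>\<tau>\<bar> \<le> 12 * C * E" using same(2) by (simp add: mult.assoc)
  have "(\<Sum>l\<in>F. \<bar>d l\<bar>) \<le> E / 2" if F: "finite F" "0 \<notin> F" for F
  proof -
    define G where "G = F - {1}"
    have G: "finite G" "0 \<notin> G" "1 \<notin> G" using F by (auto simp: G_def)
    have "(\<Sum>l\<in>F. \<bar>d l\<bar>) = (\<Sum>l\<in>G. \<bar>d l\<bar>)"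
      unfolding G_def using F same by (intro sum.mono_neutral_right) (auto simp: d_def)
    moreover have "c / 2 * (\<Sum>l\<in>G. \<bar>d l\<bar>)
        \<le> (\<Sum>l\<in>G. \<bar>quad a l x d\<bar>) + (\<Sum>l\<in>G. \<bar>quad a l d y\<bar>) + 12 * C * E * (\<Sum>l\<in>G. real l * \<bar>y l\<bar>)"
      unfolding sum_distrib_left sum.distrib[symmetric]
    proof (rule sum_mono)
      fix l assume "l \<in> G"
      then have l: "l > 1" using G by (metis One_nat_def Suc_lessI neq0_conv)
      have "1 * (c / 2) \<le> real l * \<bar>2 / k - a l\<bar>"
        using gap[OF l] x(4) l c abs_triangle_ineq2[of "a 1 - a l" "a 1 - 2 / k"]
        by (intro mult_mono) (auto simp: abs_minus_commute)
      then have "c / 2 * \<bar>d l\<bar> \<le> real l * \<bar>2 / k - a l\<bar> * \<bar>d l\<bar>" by (intro mult_right_mono) auto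
      also have "\<dots> = \<bar>quad a l x d + quad a l d y - \<tau> * (real l * y l)\<bar>"
      proof -
        have "real l * (2 / k - a l) * d l = quad a l x d + quad a l d y - \<tau> * (real l * y l)"
          using eq[of l] l by simp
        then show ?thesis by (metis abs_mult abs_of_nat)
      qed
      also have "\<dots> \<le> \<bar>quad a l x d\<bar> + \<bar>quad a l d y\<bar> + \<bar>\<tau>\<bar> * (real l * \<bar>y l\<bar>)"
        using abs_triangle_ineq4[of "quad a l x d + quad a l d y" "\<tau> * (real l * y l)"]
          abs_triangle_ineq[of "quad a l x d" "quad a l d y"] by (simp add: abs_mult)
      also have "\<bar>\<tau>\<bar> * (real l * \<bar>y l\<bar>) \<le> 12 * C * E * (real l * \<bar>y l\<bar>)"
        using \<tau> by (intro mult_right_mono) auto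
      finally show "c / 2 * \<bar>d l\<bar> \<le> \<bar>quad a l x d\<bar> + \<bar>quad a l d y\<bar> + 12 * C * E * (real l * \<bar>y l\<bar>)"
        by simp
    qed
    moreover have "\<dots> \<le> c / 4 * E"
    proof -
      have "(\<Sum>l\<in>G. \<bar>quad a l x d\<bar>) \<le> 3 * C * (c / (48 * C)) * E"
        using quad_bound[OF x(1) d G(1)] mult_right_mono[OF mult_left_mono[OF x(5), of "3 * C"] E0] C_pos
        by (simp add: E_def)
      moreover have "(\<Sum>l\<in>G. \<bar>quad a l d y\<bar>) \<le> 3 * C * (c / (48 * C)) * E"
        using quad_bound[OF d y(1) G(1)] mult_right_mono[OF mult_left_mono[OF y(5), of "3 * C"] E0] C_pos
        by (simp add: E_def mult_ac)
      moreover have "(\<Sum>l\<in>G. real l * \<bar>y l\<bar>) \<le> c / (96 * C)"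
      proof -
        have "(\<Sum>l\<in>G. real l * \<bar>y l\<bar>) \<le> 6 * C / c * (l1norm y)\<^sup>2"
          by (rule zero_high_modes[OF gap c y(1-4) G])
        also have "\<dots> \<le> 6 * C / c * (c / (48 * C))\<^sup>2"
          using y(5) c C_pos by (intro mult_left_mono power_mono l1norm_nonneg) auto
        also have "\<dots> \<le> c / (96 * C)" using c C_pos by (simp add: field_simps power2_eq_square)
        finally show ?thesis .
      qed
      then have "12 * C * E * (\<Sum>l\<in>G. real l * \<bar>y l\<bar>) \<le> 12 * C * E * (c / (96 * C))"
        using C_pos E0 by (intro mult_left_mono) auto
      ultimately have "(\<Sum>l\<in>G. \<bar>quad a l x d\<bar>) + (\<Sum>l\<in>G. \<bar>quad a l d y\<bar>) + 12 * C * E * (\<Sum>l\<in>G. real l * \<bar>y l\<bar>)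
          \<le> 3 * C * (c / (48 * C)) * E + 3 * C * (c / (48 * C)) * E + 12 * C * E * (c / (96 * C))"
        by linarith
      also have "\<dots> = c / 4 * E" using C_pos by (simp add: field_simps)
      finally show ?thesis .
    qed
    ultimately have "c / 2 * (\<Sum>l\<in>F. \<bar>d l\<bar>) \<le> c / 4 * E" by simp
    then show ?thesis using c by (simp add: field_simps)
  qed
  then have "E \<le> E / 2"
    using ell1_of_finite_bound(2)[of d "E / 2"] d by (simp add: E_def ell1_def)
  then have E: "E = 0" using E0 by simp
  then have "d l = 0" for l using component_le_l1norm[OF d, of l] by (simp add: E_def)
  then show "x = y" by (auto simp: d_def)
  have "\<tau> = 0" using \<tau> E by simp
  then show "k = k'" using x(2) y(2) by (simp add: \<tau>_def field_simps)
qed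

text \<open>
  A small nontrivial zero has a small first mode \<open>t \<noteq> 0\<close>. Since \<open>p s = s * e\<^sub>1 + o(s)\<close>, the
  first mode of the curve is at least \<open>r / 2\<close> at \<open>r\<close> and at most \<open>- r / 2\<close> at \<open>- r\<close>, so it takes
  the value \<open>t\<close> in between, and the zero agrees with the point of the curve found there. The
  choice \<open>r < \<eta>\<close> puts the parameter of that point into the required interval.
\<close>
lemma first_mode_branch_locally_unique:
  assumes a1: "a 1 > 0" and simple: "\<And>l. l > 1 \<Longrightarrow> a l \<noteq> a 1"
    and branch: "first_mode_branch a (2 / a 1) \<delta> p \<kappa>"
  shows "locally_unique_branch a (2 / a 1) \<delta> p \<kappa>"
  unfolding locally_unique_branch_def
proof
  obtain c where c: "c > 0" and gap: "\<And>l. l > 1 \<Longrightarrow> c \<le> \<bar>a 1 - a l\<bar>"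
    using spectral_gap[of 1] a1 simple by (metis less_imp_le)
  let ?K = embedding_const
  note K = embedding_const_pos
  have nt: "nontrivial_branch a (2 / a 1) \<delta> p \<kappa>" using branch by (simp add: first_mode_branch_def)
  have \<delta>: "0 < \<delta>" and p0: "p 0 = (\<lambda>l. 0)" and \<kappa>0: "\<kappa> 0 = 2 / a 1"
    and zero: "\<And>s. s \<in> {-\<delta><..<\<delta>} \<Longrightarrow> p s \<in> ell2w \<and> 0 < \<kappa> s \<and> MV_zero a (p s) (\<kappa> s)"
    and lim: "\<And>s. s \<in> {-\<delta><..<\<delta>} \<Longrightarrow>
        ((\<lambda>t. wnorm (\<lambda>l. p t l - p s l)) \<longlongrightarrow> 0) (at s within {-\<delta><..<\<delta>})"
    and \<kappa>cont: "continuous_on {-\<delta><..<\<delta>} \<kappa>"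
    using nt by (auto simp: nontrivial_branch_def)
  define \<epsilon>0 where "\<epsilon>0 = min (c / 2) (c / (48 * C))"
  have \<epsilon>0: "\<epsilon>0 > 0" using c C_pos by (simp add: \<epsilon>0_def)
  obtain \<epsilon>1 where \<epsilon>1: "\<epsilon>1 > 0" "\<And>x. x \<in> ell2w \<Longrightarrow> wnorm x < \<epsilon>1 \<Longrightarrow> l1norm x < \<epsilon>0"
    "\<And>k. \<bar>k - 2 / a 1\<bar> < \<epsilon>1 \<Longrightarrow> \<bar>2 / k - a 1\<bar> < \<epsilon>0"
    using ell2w_nhd_imp_ell1_nhd[OF a1 \<epsilon>0] by blast
  have "0 \<in> {-\<delta><..<\<delta>}" using \<delta> by simp
  have at0: "at 0 within {-\<delta><..<\<delta>} = at (0::real)" using \<delta> by (intro at_within_open) auto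
  have "eventually (\<lambda>t. wnorm (p t) < \<epsilon>1) (at 0)"
    using order_tendstoD(2)[OF lim[OF \<open>0 \<in> _\<close>] \<epsilon>1(1)] by (simp add: p0 at0)
  moreover have "(\<kappa> \<longlongrightarrow> 2 / a 1) (at 0)"
    using \<kappa>cont \<open>0 \<in> {-\<delta><..<\<delta>}\<close> by (auto simp: continuous_on_def at0 \<kappa>0 dest!: bspec[of _ _ 0])
  then have "eventually (\<lambda>t. \<bar>\<kappa> t - 2 / a 1\<bar> < \<epsilon>1) (at 0)"
    using \<epsilon>1(1) by (auto simp: tendsto_iff dist_real_def)
  moreover have "eventually (\<lambda>s. wnorm (\<lambda>l. p s l - s * unit_seq 1 l) / \<bar>s\<bar> < 1 / (2 * ?K)) (at 0)"
    using branch K by (intro order_tendstoD(2)) (auto simp: first_mode_branch_def)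
  ultimately have "eventually (\<lambda>s. wnorm (p s) < \<epsilon>1 \<and> \<bar>\<kappa> s - 2 / a 1\<bar> < \<epsilon>1
      \<and> wnorm (\<lambda>l. p s l - s * unit_seq 1 l) / \<bar>s\<bar> < 1 / (2 * ?K)) (at 0)"
    by (intro eventually_conj)
  then obtain d where d: "d > 0" "\<And>s. s \<noteq> 0 \<Longrightarrow> \<bar>s\<bar> < d \<Longrightarrow> wnorm (p s) < \<epsilon>1 \<and> \<bar>\<kappa> s - 2 / a 1\<bar> < \<epsilon>1
      \<and> wnorm (\<lambda>l. p s l - s * unit_seq 1 l) / \<bar>s\<bar> < 1 / (2 * ?K)"
    by (auto simp: eventually_at dist_real_def)
  have first_mode: "\<bar>p s 1 - s\<bar> \<le> \<bar>s\<bar> / 2" if s: "s \<noteq> 0" "\<bar>s\<bar> < d" "\<bar>s\<bar> < \<delta>" for s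
  proof -
    have "(\<lambda>l. p s l - s * unit_seq 1 l) \<in> ell2w"
      using zero[of s] s(3) by (intro ell2w_diff unit_seq_ell2w) (simp_all add: abs_less_iff minus_less_iff)
    from component_le_wnorm[OF this, of 1]
    have "\<bar>p s 1 - s\<bar> \<le> ?K * wnorm (\<lambda>l. p s l - s * unit_seq 1 l)" by (simp add: unit_seq_def)
    also have "\<dots> \<le> ?K * (\<bar>s\<bar> / (2 * ?K))"
      using d(2)[OF s(1,2)] s(1) K by (intro mult_left_mono) (auto simp: field_simps)
    finally show ?thesis using K by simp
  qed
  have cont1: "continuous_on {-\<delta><..<\<delta>} (\<lambda>s. p s 1)"
    unfolding continuous_on_def
  proof
    fix s assume s: "s \<in> {-\<delta><..<\<delta>}"
    have "((\<lambda>t. p t 1 - p s 1) \<longlongrightarrow> 0) (at s within {-\<delta><..<\<delta>})"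
    proof (rule Lim_null_comparison)
      show "((\<lambda>t. ?K * wnorm (\<lambda>l. p t l - p s l)) \<longlongrightarrow> 0) (at s within {-\<delta><..<\<delta>})"
        using tendsto_mult_right_zero[OF lim[OF s]] .
      have "norm (p t 1 - p s 1) \<le> ?K * wnorm (\<lambda>l. p t l - p s l)" if "t \<in> {-\<delta><..<\<delta>}" for t
        using component_le_wnorm[OF ell2w_diff[of "p t" "p s"], of 1] zero[OF s] zero[OF that] by simp
      then show "\<forall>\<^sub>F t in at s within {-\<delta><..<\<delta>}. norm (p t 1 - p s 1) \<le> ?K * wnorm (\<lambda>l. p t l - p s l)"
        by (auto simp: eventually_at_filter)
    qed
    then show "((\<lambda>t. p t 1) \<longlongrightarrow> p s 1) (at s within {-\<delta><..<\<delta>})"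
      using Lim_null by blast
  qed
  fix \<eta> assume \<eta>: "\<eta> \<in> {0<..\<delta>}"
  define r where "r = min d \<eta> / 2"
  have r: "0 < r" "r < d" "r < \<eta>" "r < \<delta>" using d(1) \<eta> by (auto simp: r_def)
  \<comment> \<open>The second bound keeps the first mode of a zero in the ball below \<open>r / 2\<close>.\<close>
  define \<epsilon> where "\<epsilon> = min \<epsilon>1 (r / (2 * ?K))"
  show "\<exists>\<epsilon>>0. \<forall>x\<in>ell2w. \<forall>k>0. MV_zero a x k \<and> x \<noteq> (\<lambda>l. 0) \<and> wnorm x < \<epsilon> \<and> \<bar>k - 2 / a 1\<bar> < \<epsilon> \<longrightarrow>
      (\<exists>s\<in>{-\<eta><..<\<eta>}. x = p s \<and> k = \<kappa> s)"
  proof (intro exI[of _ \<epsilon>] conjI ballI allI impI)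
    show "\<epsilon> > 0" using \<epsilon>1 r K by (simp add: \<epsilon>_def)
    fix x k assume x: "x \<in> ell2w" and k: "0 < k"
      and *: "MV_zero a x k \<and> x \<noteq> (\<lambda>l. 0) \<and> wnorm x < \<epsilon> \<and> \<bar>k - 2 / a 1\<bar> < \<epsilon>"
    have x1: "x \<in> ell1" by (rule ell2w_imp_ell1[OF x])
    have xs: "l1norm x < \<epsilon>0" "\<bar>2 / k - a 1\<bar> < \<epsilon>0" using \<epsilon>1(2)[OF x] \<epsilon>1(3)[of k] * by (auto simp: \<epsilon>_def)
    have "c / (48 * C) \<le> c / (12 * C)" using c C_pos by (simp add: field_simps)
    then have "\<epsilon>0 \<le> c / (12 * C)" unfolding \<epsilon>0_def by linarith
    then have "l1norm x \<le> 2 * \<bar>x 1\<bar>"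
      using xs * by (intro zero_first_mode_dominates[OF gap c x1 k]) (auto simp: \<epsilon>0_def)
    have x1nz: "x 1 \<noteq> 0"
    proof
      assume "x 1 = 0"
      then have "l1norm x \<le> 0" using \<open>l1norm x \<le> 2 * \<bar>x 1\<bar>\<close> by simp
      then have "x l = 0" for l using component_le_l1norm[OF x1, of l] by simp
      then show False using * by auto
    qed
    have "\<bar>x 1\<bar> \<le> ?K * wnorm x" by (rule component_le_wnorm[OF x])
    also have "\<dots> \<le> ?K * (r / (2 * ?K))" using * K by (intro mult_left_mono) (auto simp: \<epsilon>_def)
    finally have "\<bar>x 1\<bar> \<le> r / 2" using K by simp
    moreover have "r / 2 \<le> p r 1" "p (-r) 1 \<le> - (r / 2)"
      using first_mode[of r] first_mode[of "-r"] r unfolding abs_le_iff by auto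
    ultimately have "p (-r) 1 \<le> x 1" "x 1 \<le> p r 1" by auto
    moreover have "continuous_on {-r..r} (\<lambda>s. p s 1)"
      by (rule continuous_on_subset[OF cont1]) (use r in auto)
    ultimately obtain s where s: "-r \<le> s" "s \<le> r" "p s 1 = x 1"
      using IVT'[of "\<lambda>s. p s 1" "-r" "x 1" r] r(1) by force
    have s0: "s \<noteq> 0" using s(3) x1nz by (auto simp: p0)
    have sd: "s \<in> {-\<delta><..<\<delta>}" using s r by auto
    have ps: "wnorm (p s) < \<epsilon>1" "\<bar>\<kappa> s - 2 / a 1\<bar> < \<epsilon>1" using d(2)[OF s0] s r by auto
    have ps: "l1norm (p s) < \<epsilon>0" "\<bar>2 / \<kappa> s - a 1\<bar> < \<epsilon>0"
      using \<epsilon>1(2)[of "p s"] \<epsilon>1(3)[of "\<kappa> s"] ps zero[OF sd] by auto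
    have le: "\<epsilon>0 \<le> c / 2" "\<epsilon>0 \<le> c / (48 * C)" by (simp_all add: \<epsilon>0_def)
    note px = zero[OF sd, THEN conjunct1, THEN ell2w_imp_ell1(1)] zero[OF sd, THEN conjunct2, THEN conjunct1]
      zero[OF sd, THEN conjunct2, THEN conjunct2]
    note eq = zero_determined_by_first_mode[OF gap c x1 k conjunct1[OF *] _ _ px _ _ s(3)[symmetric] x1nz]
    have "x = p s" "k = \<kappa> s"
      by (rule eq; use xs ps le in linarith)+
    then show "\<exists>s\<in>{-\<eta><..<\<eta>}. x = p s \<and> k = \<kappa> s" using s r by (intro bexI[of _ s]) auto
  qed
qed

end

section \<open>Rescaling the modes\<close>

definition spread :: "nat \<Rightarrow> (nat \<Rightarrow> real) \<Rightarrow> nat \<Rightarrow> real" where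
  "spread m y = (\<lambda>j. if m dvd j then y (j div m) else 0)"

lemma spread_mult [simp]: "m \<ge> 1 \<Longrightarrow> spread m y (l * m) = y l"
  by (simp add: spread_def)

lemma weighted_sum_spread:
  assumes m: "m \<ge> 1"
  shows "summable (\<lambda>l. (1 + (real (l * m))\<^sup>2) * (y l)\<^sup>2) \<longleftrightarrow>
         summable (\<lambda>j. (1 + (real j)\<^sup>2) * (spread m y j)\<^sup>2)"
    and "(\<Sum>l. (1 + (real (l * m))\<^sup>2) * (y l)\<^sup>2) = (\<Sum>j. (1 + (real j)\<^sup>2) * (spread m y j)\<^sup>2)"
proof -
  have mono: "strict_mono (\<lambda>l. l * m)" using m by (auto simp: strict_mono_def)
  have z: "(1 + (real j)\<^sup>2) * (spread m y j)\<^sup>2 = 0" if "j \<notin> range (\<lambda>l. l * m)" for j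
    using that by (auto simp: spread_def image_iff mult.commute elim!: dvdE)
  show "summable (\<lambda>l. (1 + (real (l * m))\<^sup>2) * (y l)\<^sup>2) \<longleftrightarrow>
         summable (\<lambda>j. (1 + (real j)\<^sup>2) * (spread m y j)\<^sup>2)"
    using summable_mono_reindex[of "\<lambda>l. l * m" "\<lambda>j. (1 + (real j)\<^sup>2) * (spread m y j)\<^sup>2", OF mono z] m
    by simp
  show "(\<Sum>l. (1 + (real (l * m))\<^sup>2) * (y l)\<^sup>2) = (\<Sum>j. (1 + (real j)\<^sup>2) * (spread m y j)\<^sup>2)"
    using suminf_mono_reindex[of "\<lambda>l. l * m" "\<lambda>j. (1 + (real j)\<^sup>2) * (spread m y j)\<^sup>2", OF mono z] m
    by simp
qed

lemma weight_bounds: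
  assumes "m \<ge> 1"
  shows "(1 + (real l)\<^sup>2) * t\<^sup>2 \<le> (1 + (real (l * m))\<^sup>2) * t\<^sup>2"
    and "(1 + (real (l * m))\<^sup>2) * t\<^sup>2 \<le> (real m)\<^sup>2 * ((1 + (real l)\<^sup>2) * t\<^sup>2)"
proof -
  have m1: "1 \<le> (real m)\<^sup>2" using assms by simp
  have "(real l)\<^sup>2 * 1 \<le> (real l)\<^sup>2 * (real m)\<^sup>2" using m1 by (intro mult_left_mono) auto
  then show "(1 + (real l)\<^sup>2) * t\<^sup>2 \<le> (1 + (real (l * m))\<^sup>2) * t\<^sup>2"
    by (intro mult_right_mono) (auto simp: power_mult_distrib)
  have "1 + (real (l * m))\<^sup>2 \<le> (real m)\<^sup>2 * (1 + (real l)\<^sup>2)"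
    using m1 by (simp add: power_mult_distrib algebra_simps)
  from mult_right_mono[OF this, of "t\<^sup>2"]
  show "(1 + (real (l * m))\<^sup>2) * t\<^sup>2 \<le> (real m)\<^sup>2 * ((1 + (real l)\<^sup>2) * t\<^sup>2)"
    by (simp add: mult.assoc)
qed

lemma spread_ell2w:
  assumes m: "m \<ge> 1"
  shows "spread m y \<in> ell2w \<longleftrightarrow> y \<in> ell2w"
proof
  assume *: "y \<in> ell2w"
  then have "summable (\<lambda>l. (real m)\<^sup>2 * ((1 + (real l)\<^sup>2) * (y l)\<^sup>2))"
    by (intro summable_mult) (auto simp: ell2w_def)
  then have "summable (\<lambda>l. (1 + (real (l * m))\<^sup>2) * (y l)\<^sup>2)"
    by (rule summable_comparison_test'[where N=0])
      (use weight_bounds(2)[OF m] in auto)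
  then show "spread m y \<in> ell2w" using * weighted_sum_spread(1)[OF m] by (simp add: ell2w_def spread_def)
next
  assume *: "spread m y \<in> ell2w"
  then have "summable (\<lambda>l. (1 + (real (l * m))\<^sup>2) * (y l)\<^sup>2)"
    using weighted_sum_spread(1)[OF m] by (simp add: ell2w_def)
  then have "summable (\<lambda>l. (1 + (real l)\<^sup>2) * (y l)\<^sup>2)"
    by (rule summable_comparison_test'[where N=0])
      (use weight_bounds(1)[OF m] in auto)
  then show "y \<in> ell2w" using * by (simp add: ell2w_def spread_def)
qed

lemma wnorm_spread:
  assumes m: "m \<ge> 1" and y: "y \<in> ell2w"
  shows "wnorm y \<le> wnorm (spread m y)" "wnorm (spread m y) \<le> real m * wnorm y"
proof -
  have sy: "summable (\<lambda>l. (1 + (real l)\<^sup>2) * (y l)\<^sup>2)" using y by (simp add: ell2w_def)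
  have ss: "summable (\<lambda>l. (1 + (real (l * m))\<^sup>2) * (y l)\<^sup>2)"
    using y weighted_sum_spread(1)[OF m, of y] spread_ell2w[OF m, of y] by (simp add: ell2w_def)
  show "wnorm y \<le> wnorm (spread m y)"
    unfolding wnorm_def weighted_sum_spread(2)[OF m, symmetric]
    by (intro real_sqrt_le_mono suminf_le sy ss weight_bounds(1)[OF m])
  have "(\<Sum>l. (1 + (real (l * m))\<^sup>2) * (y l)\<^sup>2) \<le> (\<Sum>l. (real m)\<^sup>2 * ((1 + (real l)\<^sup>2) * (y l)\<^sup>2))"
    by (intro suminf_le ss summable_mult sy weight_bounds(2)[OF m])
  also have "\<dots> = (real m)\<^sup>2 * (\<Sum>l. (1 + (real l)\<^sup>2) * (y l)\<^sup>2)" by (rule suminf_mult[OF sy])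
  finally show "wnorm (spread m y) \<le> real m * wnorm y"
    unfolding wnorm_def weighted_sum_spread(2)[OF m, symmetric]
    by (drule_tac real_sqrt_le_mono) (simp add: real_sqrt_mult)
qed

text \<open>
  The factor \<open>m\<close> is that of \<open>j * m * a (j * m)\<close> over \<open>j * rescaled_coeffs m a j\<close>. The linear part
  carries the same factor, so that it cancels in the equations.
\<close>
lemma quad_spread:
  assumes m: "m \<ge> 1"
  shows "quad a (l * m) (spread m y) (spread m y) = real m * quad (rescaled_coeffs m a) l y y"
proof -
  let ?t = "\<lambda>(j, k). coupling a (l * m) j k * spread m y j * spread m y k"
  let ?h = "\<lambda>(j, k). (j * m, k * m)"
  have "quad a (l * m) (spread m y) (spread m y) = infsum ?t (range ?h)"
    unfolding quad_def
  proof (rule infsum_cong_neutral)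
    fix p :: "nat \<times> nat" assume p: "p \<in> UNIV - range ?h"
    obtain j k where jk: "p = (j, k)" by (cases p)
    have "\<not> (m dvd j \<and> m dvd k)" using p by (auto simp: jk image_iff mult.commute elim!: dvdE)
    then show "?t p = 0" by (auto simp: jk spread_def)
  qed auto
  also have "\<dots> = infsum (?t \<circ> ?h) UNIV"
    using m by (intro infsum_reindex) (auto simp: inj_on_def)
  also have "\<dots> = (\<Sum>\<^sub>\<infinity>p. real m * (case p of (j, k) \<Rightarrow> coupling (rescaled_coeffs m a) l j k * y j * y k))"
  proof (rule infsum_cong)
    fix p :: "nat \<times> nat"
    obtain j k where jk: "p = (j, k)" by (cases p)
    have "coupling a (l * m) (j * m) (k * m) = real m * coupling (rescaled_coeffs m a) l j k"
    proof -
      have "j * m + k * m = l * m \<longleftrightarrow> j + k = l" "j * m = k * m + l * m \<longleftrightarrow> j = k + l"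
        using m by (simp_all flip: add_mult_distrib)
      then show ?thesis by (simp add: coupling_def rescaled_coeffs_def right_diff_distrib)
    qed
    then show "(?t \<circ> ?h) p = real m * (case p of (j, k) \<Rightarrow> coupling (rescaled_coeffs m a) l j k * y j * y k)"
      using m by (simp add: jk)
  qed
  also have "\<dots> = real m * quad (rescaled_coeffs m a) l y y"
    unfolding quad_def by (rule infsum_cmult_right')
  finally show ?thesis .
qed

lemma (in bounded_coeffs) bounded_coeffs_rescaled:
  assumes "m \<ge> 1"
  shows "bounded_coeffs (rescaled_coeffs m a) C"
proof
  fix l
  have "real l * \<bar>a (l * m)\<bar> \<le> real (l * m) * \<bar>a (l * m)\<bar>"
    using assms by (intro mult_right_mono) (simp_all add: mult_le_cancel_left1 del: of_nat_mult)
  also have "\<dots> \<le> C" by (rule coeff_bound)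
  finally show "real l * \<bar>rescaled_coeffs m a l\<bar> \<le> C" by (simp add: rescaled_coeffs_def)
qed (rule C_pos)

text \<open>
  The equations at multiples of \<open>m\<close> are \<open>m\<close> times those for the rescaled coefficients; at the
  other modes both sides vanish.
\<close>
lemma (in bounded_coeffs) MV_zero_spread:
  assumes m: "m \<ge> 1" and y: "y \<in> ell2w" and k: "k > 0"
  shows "MV_zero a (spread m y) k \<longleftrightarrow> MV_zero (rescaled_coeffs m a) y k"
proof -
  interpret b: bounded_coeffs "rescaled_coeffs m a" C by (rule bounded_coeffs_rescaled[OF m])
  have sp: "spread m y \<in> ell1" using y spread_ell2w[OF m] ell2w_imp_ell1 by blast
  have mult: "real (l * m) * (2 / k - a (l * m)) * spread m y (l * m) = quad a (l * m) (spread m y) (spread m y)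
      \<longleftrightarrow> real l * (2 / k - rescaled_coeffs m a l) * y l = quad (rescaled_coeffs m a) l y y" for l
  proof -
    have eq: "real (l * m) * (2 / k - a (l * m)) * spread m y (l * m)
        = real m * (real l * (2 / k - rescaled_coeffs m a l) * y l)"
      using m by (simp add: rescaled_coeffs_def)
    then show ?thesis unfolding eq quad_spread[OF m] using m by simp
  qed
  have nonmult: "real j * (2 / k - a j) * spread m y j = quad a j (spread m y) (spread m y)" if "\<not> m dvd j" for j
    using quad_periodic_eq_0[of m "spread m y" j] that by (simp add: spread_def)
  show ?thesis
    unfolding MV_zero_iff[OF sp k] b.MV_zero_iff[OF ell2w_imp_ell1(1)[OF y] k]
  proof (intro iffI allI impI)
    fix l :: nat assume H: "\<forall>l\<ge>1. real l * (2 / k - a l) * spread m y l = quad a l (spread m y) (spread m y)"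
      and l: "l \<ge> 1"
    have "l * m \<ge> 1" using l m by (simp add: Suc_le_eq)
    with H show "real l * (2 / k - rescaled_coeffs m a l) * y l = quad (rescaled_coeffs m a) l y y"
      using mult by blast
  next
    fix j :: nat assume H: "\<forall>l\<ge>1. real l * (2 / k - rescaled_coeffs m a l) * y l = quad (rescaled_coeffs m a) l y y"
      and j: "j \<ge> 1"
    show "real j * (2 / k - a j) * spread m y j = quad a j (spread m y) (spread m y)"
    proof (cases "m dvd j")
      case True
      then obtain l where l: "j = l * m" by (metis dvdE mult.commute)
      then have "l \<ge> 1" using j by (cases l) auto
      then show ?thesis using H mult[of l] l by blast
    qed (rule nonmult)
  qed
qed

lemma spread_diff: "(\<lambda>l. spread m x l - spread m y l) = spread m (\<lambda>l. x l - y l)"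
  by (auto simp: spread_def)

lemma spread_eq_0_iff:
  assumes m: "m \<ge> 1"
  shows "spread m y = (\<lambda>l. 0) \<longleftrightarrow> y = (\<lambda>l. 0)"
proof
  assume "spread m y = (\<lambda>l. 0)"
  then have "spread m y (l * m) = 0" for l by simp
  then show "y = (\<lambda>l. 0)" using m by auto
qed (auto simp: spread_def)

lemma mode_periodic_eq_spread:
  assumes "m \<ge> 1" "x 0 = 0" "mode_periodic m x"
  shows "x = spread m (\<lambda>l. x (l * m))"
proof
  fix j show "x j = spread m (\<lambda>l. x (l * m)) j"
    using assms by (cases "j = 0") (auto simp: mode_periodic_def spread_def)
qed

context bounded_coeffs begin

lemma spread_branch:
  assumes m: "m \<ge> 1" and branch: "nontrivial_branch (rescaled_coeffs m a) \<kappa>\<^sub>b \<delta> y \<kappa>"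
  shows "nontrivial_branch a \<kappa>\<^sub>b \<delta> (\<lambda>s. spread m (y s)) \<kappa>"
proof -
  have y: "y s \<in> ell2w" "0 < \<kappa> s" if "s \<in> {-\<delta><..<\<delta>}" for s
    using that branch by (auto simp: nontrivial_branch_def)
  have "((\<lambda>t. wnorm (\<lambda>l. spread m (y t) l - spread m (y s) l)) \<longlongrightarrow> 0) (at s within {-\<delta><..<\<delta>})"
    if s: "s \<in> {-\<delta><..<\<delta>}" for s
  proof (rule Lim_null_comparison)
    have "((\<lambda>t. wnorm (\<lambda>l. y t l - y s l)) \<longlongrightarrow> 0) (at s within {-\<delta><..<\<delta>})"
      using branch s unfolding nontrivial_branch_def by blast
    then show "((\<lambda>t. real m * wnorm (\<lambda>l. y t l - y s l)) \<longlongrightarrow> 0) (at s within {-\<delta><..<\<delta>})"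
      by (rule tendsto_mult_right_zero)
    have "norm (wnorm (spread m (\<lambda>l. y t l - y s l))) \<le> real m * wnorm (\<lambda>l. y t l - y s l)"
      if "t \<in> {-\<delta><..<\<delta>}" for t
    proof -
      have d: "(\<lambda>l. y t l - y s l) \<in> ell2w" using y s that by (intro ell2w_diff) auto
      then show ?thesis
        using wnorm_spread(2)[OF m d] wnorm_nonneg[of "spread m (\<lambda>l. y t l - y s l)"] spread_ell2w[OF m]
        by simp
    qed
    then show "\<forall>\<^sub>F t in at s within {-\<delta><..<\<delta>}.
        norm (wnorm (\<lambda>l. spread m (y t) l - spread m (y s) l)) \<le> real m * wnorm (\<lambda>l. y t l - y s l)"
      by (auto simp: eventually_at_filter spread_diff)
  qed
  moreover have "MV_zero a (spread m (y s)) (\<kappa> s)" if "s \<in> {-\<delta><..<\<delta>}" for s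
    using branch that y[OF that] by (simp add: MV_zero_spread[OF m] nontrivial_branch_def)
  moreover have "spread m (y 0) = (\<lambda>l. 0)"
    using branch by (auto simp: spread_def nontrivial_branch_def)
  ultimately show ?thesis
    using branch unfolding nontrivial_branch_def spread_ell2w[OF m] spread_eq_0_iff[OF m] by blast
qed

text \<open>
  If \<open>m\<close> is the only critical mode, small zeros are \<open>m\<close>-periodic, hence come from small zeros for
  the rescaled coefficients, to which the assumed uniqueness applies.
\<close>
lemma spread_branch_locally_unique:
  assumes m: "m \<ge> 1" "a m > 0" and simple: "\<And>l. l \<ge> 1 \<Longrightarrow> l \<noteq> m \<Longrightarrow> a l \<noteq> a m"
    and unique: "locally_unique_branch (rescaled_coeffs m a) (2 / a m) \<delta> y \<kappa>"
  shows "locally_unique_branch a (2 / a m) \<delta> (\<lambda>s. spread m (y s)) \<kappa>"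
  unfolding locally_unique_branch_def
proof
  fix \<eta> assume "\<eta> \<in> {0<..\<delta>}"
  with unique have "\<exists>\<epsilon>>0. \<forall>x\<in>ell2w. \<forall>k>0. MV_zero (rescaled_coeffs m a) x k \<and> x \<noteq> (\<lambda>l. 0) \<and> wnorm x < \<epsilon>
      \<and> \<bar>k - 2 / a m\<bar> < \<epsilon> \<longrightarrow> (\<exists>s\<in>{-\<eta><..<\<eta>}. x = y s \<and> k = \<kappa> s)"
    unfolding locally_unique_branch_def by (rule bspec)
  then obtain \<epsilon>1 where \<epsilon>1: "\<epsilon>1 > 0" "\<forall>x\<in>ell2w. \<forall>k>0. MV_zero (rescaled_coeffs m a) x k \<and> x \<noteq> (\<lambda>l. 0)
      \<and> wnorm x < \<epsilon>1 \<and> \<bar>k - 2 / a m\<bar> < \<epsilon>1 \<longrightarrow> (\<exists>s\<in>{-\<eta><..<\<eta>}. x = y s \<and> k = \<kappa> s)"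
    by (elim exE conjE)
  have "m dvd l" if "l \<ge> 1" "a l = a m" for l using simple[OF that(1)] that(2) by (cases "l = m") auto
  then obtain \<epsilon>2 where \<epsilon>2: "\<epsilon>2 > 0" "\<And>x k. x \<in> ell2w \<Longrightarrow> k > 0 \<Longrightarrow> MV_zero a x k \<Longrightarrow> wnorm x < \<epsilon>2
      \<Longrightarrow> \<bar>k - 2 / a m\<bar> < \<epsilon>2 \<Longrightarrow> mode_periodic m x"
    using small_zero_periodic[OF m(2)] by blast
  show "\<exists>\<epsilon>>0. \<forall>x\<in>ell2w. \<forall>k>0. MV_zero a x k \<and> x \<noteq> (\<lambda>l. 0) \<and> wnorm x < \<epsilon> \<and> \<bar>k - 2 / a m\<bar> < \<epsilon> \<longrightarrow>
      (\<exists>s\<in>{-\<eta><..<\<eta>}. x = spread m (y s) \<and> k = \<kappa> s)"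
  proof (intro exI[of _ "min \<epsilon>1 \<epsilon>2"] conjI ballI allI impI)
    show "min \<epsilon>1 \<epsilon>2 > 0" using \<epsilon>1 \<epsilon>2 by simp
    fix x k assume x: "x \<in> ell2w" and k: "0 < k"
      and *: "MV_zero a x k \<and> x \<noteq> (\<lambda>l. 0) \<and> wnorm x < min \<epsilon>1 \<epsilon>2 \<and> \<bar>k - 2 / a m\<bar> < min \<epsilon>1 \<epsilon>2"
    define z where "z l = x (l * m)" for l
    have "mode_periodic m x" using \<epsilon>2(2)[OF x k] * by simp
    then have xz: "x = spread m z"
      using mode_periodic_eq_spread[OF m(1)] x unfolding z_def by (auto simp: ell2w_def)
    then have z: "z \<in> ell2w" using x spread_ell2w[OF m(1)] by simp
    have "\<exists>s\<in>{-\<eta><..<\<eta>}. z = y s \<and> k = \<kappa> s"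
    proof (rule \<epsilon>1(2)[rule_format, OF z k], intro conjI)
      show "MV_zero (rescaled_coeffs m a) z k" using * MV_zero_spread[OF m(1) z k] xz by simp
      show "z \<noteq> (\<lambda>l. 0)" using * spread_eq_0_iff[OF m(1)] xz by blast
      show "wnorm z < \<epsilon>1" using * wnorm_spread(1)[OF m(1) z] xz by auto
    qed (use * in auto)
    then show "\<exists>s\<in>{-\<eta><..<\<eta>}. x = spread m (y s) \<and> k = \<kappa> s" using xz by auto
  qed
qed

end

section \<open>Construction of the branch as a power series\<close>

text \<open>
  Comparison of the coefficients of \<open>s ^ Suc n\<close> in
  \<open>l * (a 1 - a l) * u l = s * (Q l u u - l * Q 1 u u * u l)\<close> for \<open>l \<ge> 2\<close>, where
  \<open>u = (\<Sum>n. s ^ n * U n)\<close>. The normalization \<open>u 1 = 1\<close> fixes \<open>U 0\<close> and lets the first mode of all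
  later coefficients vanish.
\<close>
fun branch_coeff :: "(nat \<Rightarrow> real) \<Rightarrow> nat \<Rightarrow> nat \<Rightarrow> real" where
  "branch_coeff a 0 = unit_seq 1"
| "branch_coeff a (Suc n) = (\<lambda>l. if l \<le> 1 then 0 else
     ((\<Sum>i\<le>n. quad a l (branch_coeff a i) (branch_coeff a (n - i)))
       - real l * (\<Sum>i\<le>n. (\<Sum>k\<le>i. quad a 1 (branch_coeff a k) (branch_coeff a (i - k)))
                            * branch_coeff a (n - i) l))
     / (real l * (a 1 - a l)))"

text \<open>
  The coefficients of the scalar power series \<open>f = 1 + s * H * (f\<^sup>2 + f\<^sup>3)\<close>.
\<close>
fun majorant :: "real \<Rightarrow> nat \<Rightarrow> real" where
  "majorant H 0 = 1"
| "majorant H (Suc n) =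
     H * ((\<Sum>i\<le>n. majorant H i * majorant H (n - i))
        + (\<Sum>i\<le>n. (\<Sum>k\<le>i. majorant H k * majorant H (i - k)) * majorant H (n - i)))"

lemma majorant_nonneg: "H \<ge> 0 \<Longrightarrow> 0 \<le> majorant H n"
proof (induction n rule: less_induct)
  case (less n)
  then show ?case
    by (cases n) (auto intro!: mult_nonneg_nonneg add_nonneg_nonneg sum_nonneg)
qed

lemma sum_convolution_le:
  fixes f g :: "nat \<Rightarrow> real"
  assumes "\<And>i. 0 \<le> f i" "\<And>i. 0 \<le> g i"
  shows "(\<Sum>n\<le>N. \<Sum>i\<le>n. f i * g (n - i)) \<le> (\<Sum>i\<le>N. f i) * (\<Sum>i\<le>N. g i)"
proof -
  have "(\<Sum>n\<le>N. \<Sum>i\<le>n. f i * g (n - i)) = (\<Sum>(i, j)\<in>{(i, j). i + j \<le> N}. f i * g j)"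
    by (rule sum.triangle_reindex_eq[symmetric])
  also have "\<dots> \<le> (\<Sum>(i, j)\<in>{..N} \<times> {..N}. f i * g j)"
    by (rule sum_mono2) (use assms in auto)
  also have "\<dots> = (\<Sum>i\<le>N. f i) * (\<Sum>i\<le>N. g i)"
    by (simp add: sum_product sum.cartesian_product)
  finally show ?thesis .
qed

text \<open>
  Partial sums obey \<open>S (Suc N) \<le> 1 + H * \<rho> * ((S N)\<^sup>2 + (S N)\<^sup>3)\<close>, and \<open>H * \<rho> \<le> 1 / 12\<close> makes this
  recursion preserve the bound \<open>2\<close>, as \<open>2\<^sup>2 + 2\<^sup>3 = 12\<close>.
\<close>
lemma majorant_sum_le:
  assumes H: "H \<ge> 0" and \<rho>: "\<rho> \<ge> 0" "12 * H * \<rho> \<le> 1"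
  shows "(\<Sum>n\<le>N. majorant H n * \<rho> ^ n) \<le> 2"
proof (induction N)
  case (Suc N)
  define b where "b n = majorant H n * \<rho> ^ n" for n
  define e where "e n = (\<Sum>i\<le>n. b i * b (n - i))" for n
  have b0: "0 \<le> b n" for n using majorant_nonneg[OF H] \<rho> by (simp add: b_def)
  then have e0: "0 \<le> e n" for n by (simp add: e_def sum_nonneg)
  define S where "S = (\<Sum>n\<le>N. b n)"
  have S: "0 \<le> S" "S \<le> 2" using Suc b0 by (auto simp: S_def b_def sum_nonneg)
  have bSuc: "b (Suc n) = H * \<rho> * ((\<Sum>i\<le>n. b i * b (n - i)) + (\<Sum>i\<le>n. e i * b (n - i)))" for n
  proof -
    have pow: "\<rho> ^ n = \<rho> ^ i * \<rho> ^ (n - i)" if "i \<le> n" for i n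
      using that by (simp flip: power_add)
    have conv: "(\<Sum>i\<le>n. f i * g (n - i)) * \<rho> ^ n = (\<Sum>i\<le>n. (f i * \<rho> ^ i) * (g (n - i) * \<rho> ^ (n - i)))"
      for f g :: "nat \<Rightarrow> real" and n
      unfolding sum_distrib_right by (intro sum.cong refl) (simp add: pow)
    have "b (Suc n) = H * \<rho> * ((\<Sum>i\<le>n. majorant H i * majorant H (n - i)) * \<rho> ^ n
        + (\<Sum>i\<le>n. (\<Sum>k\<le>i. majorant H k * majorant H (i - k)) * majorant H (n - i)) * \<rho> ^ n)"
      by (simp add: b_def algebra_simps)
    also have "\<dots> = H * \<rho> * ((\<Sum>i\<le>n. b i * b (n - i)) + (\<Sum>i\<le>n. e i * b (n - i)))"
      using conv[of "majorant H" "majorant H" n] conv[of "\<lambda>i. \<Sum>k\<le>i. majorant H k * majorant H (i - k)" "majorant H" n]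
        conv[of "majorant H" "majorant H"] by (simp add: e_def b_def)
    finally show ?thesis .
  qed
  have "(\<Sum>n\<le>Suc N. b n) = b 0 + (\<Sum>n\<le>N. b (Suc n))"
    by (rule sum.atMost_Suc_shift)
  also have "(\<Sum>n\<le>N. b (Suc n)) = H * \<rho> * ((\<Sum>n\<le>N. \<Sum>i\<le>n. b i * b (n - i)) + (\<Sum>n\<le>N. \<Sum>i\<le>n. e i * b (n - i)))"
    by (simp only: bSuc sum_distrib_left[symmetric] sum.distrib)
  also have "\<dots> \<le> H * \<rho> * (2 * 2 + (2 * 2) * 2)"
  proof (intro mult_left_mono add_mono)
    show bb: "(\<Sum>n\<le>N. \<Sum>i\<le>n. b i * b (n - i)) \<le> 2 * 2"
      using sum_convolution_le[of b b N] b0 mult_mono[OF S(2) S(2)] S by (simp add: S_def)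
    have "(\<Sum>n\<le>N. e n) \<le> 2 * 2" using bb by (simp add: e_def)
    from mult_mono[OF this S(2)] S(1)
    show "(\<Sum>n\<le>N. \<Sum>i\<le>n. e i * b (n - i)) \<le> 2 * 2 * 2"
      using sum_convolution_le[of e b N] b0 e0 by (simp add: S_def)
  qed (use H \<rho> in auto)
  also have "\<dots> \<le> 1" using \<rho> by simp
  finally show ?case by (simp add: b_def)
qed simp

lemma has_sum_antidiagonal:
  fixes f :: "nat \<times> nat \<Rightarrow> real"
  assumes "f summable_on UNIV"
  shows "((\<lambda>n. \<Sum>i\<le>n. f (i, n - i)) has_sum infsum f UNIV) UNIV"
proof (rule has_sum_Sigma'[where B = "\<lambda>n. {..n}" and f = "\<lambda>(n, i). f (i, n - i)"])
  have "((\<lambda>(n, i). f (i, n - i)) has_sum infsum f UNIV) (Sigma UNIV (\<lambda>n. {..n})) \<longleftrightarrow> (f has_sum infsum f UNIV) UNIV"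
    by (rule has_sum_reindex_bij_witness[of _ "\<lambda>(i, j). (i + j, i)" "\<lambda>(n, i). (i, n - i)"]) auto
  then show "((\<lambda>(n, i). f (i, n - i)) has_sum infsum f UNIV) (Sigma UNIV (\<lambda>n. {..n}))"
    using assms by simp
qed (auto intro!: has_sum_finiteI)

lemma quad_scale: "quad a l (\<lambda>j. x j * s) (\<lambda>k. y k * t) = quad a l x y * (s * t)"
proof -
  have "quad a l (\<lambda>j. x j * s) (\<lambda>k. y k * t) = (\<Sum>\<^sub>\<infinity>p. (case p of (j, k) \<Rightarrow> coupling a l j k * x j * y k) * (s * t))"
    unfolding quad_def by (rule infsum_cong) (auto simp: mult_ac)
  then show ?thesis unfolding quad_def by (simp only: infsum_cmult_left')
qed

context bounded_coeffs begin

text \<open>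
  Substituting an absolutely convergent series of sequences into the quadratic part: the fourfold
  sum over \<open>(j, k)\<close> and over the two summation indices of the series may be swapped, because the
  coupling is bounded.
\<close>
lemma quad_series:
  fixes V :: "nat \<Rightarrow> nat \<Rightarrow> real"
  assumes V: "(\<lambda>(n, j). V n j) summable_on UNIV"
  defines "x \<equiv> \<lambda>j. \<Sum>\<^sub>\<infinity>n. V n j"
  shows "((\<lambda>n. \<Sum>i\<le>n. quad a l (V i) (V (n - i))) has_sum quad a l x x) UNIV"
proof -
  define G where "G = (\<lambda>((j, k), (n, p)). coupling a l j k * V n j * V p k)"
  have "(\<lambda>((n, j), (p, k)). \<bar>V n j\<bar> * \<bar>V p k\<bar>) summable_on UNIV \<times> UNIV"
  proof -
    have V': "(\<lambda>q. \<bar>case q of (n, j) \<Rightarrow> V n j\<bar>) summable_on UNIV"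
      using V by (simp add: abs_summable_on_real)
    show ?thesis using summable_on_times[OF V' V'] by (simp add: case_prod_unfold)
  qed
  moreover have "(\<lambda>((n, j), (p, k)). \<bar>V n j\<bar> * \<bar>V p k\<bar>) summable_on UNIV \<times> UNIV
      \<longleftrightarrow> (\<lambda>((j, k), (n, p)). \<bar>V n j\<bar> * \<bar>V p k\<bar>) summable_on UNIV"
    by (rule summable_on_reindex_bij_witness[of _ "\<lambda>((j, k), (n, p)). ((n, j), (p, k))"
          "\<lambda>((n, j), (p, k)). ((j, k), (n, p))"]) auto
  ultimately have "(\<lambda>((j, k), (n, p)). \<bar>V n j\<bar> * \<bar>V p k\<bar>) summable_on UNIV" by blast
  from summable_on_cmult_right[OF this, of "3 * C"]
  have Gs: "G summable_on UNIV"
  proof (rule summable_on_real_comparison)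
    fix q :: "(nat \<times> nat) \<times> nat \<times> nat"
    obtain j k n p where q: "q = ((j, k), (n, p))" by (metis surj_pair)
    show "\<bar>G q\<bar> \<le> 3 * C * (\<lambda>((j, k), (n, p)). \<bar>V n j\<bar> * \<bar>V p k\<bar>) q"
      using mult_right_mono[OF abs_coupling_le[of l j k], of "\<bar>V n j\<bar> * \<bar>V p k\<bar>"]
      by (simp add: q G_def abs_mult mult.assoc)
  qed
  have Vj: "(\<lambda>n. V n j) summable_on UNIV" for j
  proof -
    have "(\<lambda>(j, n). V n j) summable_on UNIV \<times> UNIV"
      using V summable_on_swap[of "\<lambda>(n, j). V n j" UNIV UNIV] by simp
    then show ?thesis by (rule summable_on_SigmaD1) simp
  qed
  have Gs': "(\<lambda>(jk, np). G (jk, np)) summable_on UNIV \<times> UNIV" using Gs by simp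
  have "quad a l x x = (\<Sum>\<^sub>\<infinity>jk. \<Sum>\<^sub>\<infinity>np. G (jk, np))"
    unfolding quad_def
  proof (rule infsum_cong)
    fix jk :: "nat \<times> nat"
    obtain j k where jk: "jk = (j, k)" by (cases jk)
    have "(\<Sum>\<^sub>\<infinity>np. G (jk, np)) = (\<Sum>\<^sub>\<infinity>np. coupling a l j k * (case np of (n, p) \<Rightarrow> V n j * V p k))"
      by (rule infsum_cong) (auto simp: jk G_def mult.assoc)
    also have "\<dots> = coupling a l j k * (x j * x k)"
      using infsum_times[OF Vj Vj] by (simp add: infsum_cmult_right' x_def)
    finally show "(case jk of (j, k) \<Rightarrow> coupling a l j k * x j * x k) = (\<Sum>\<^sub>\<infinity>np. G (jk, np))"
      by (simp add: jk mult.assoc)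
  qed
  also have "\<dots> = (\<Sum>\<^sub>\<infinity>np. \<Sum>\<^sub>\<infinity>jk. G (jk, np))"
    by (rule infsum_swap_banach[OF Gs'])
  also have "\<dots> = (\<Sum>\<^sub>\<infinity>(n, p). quad a l (V n) (V p))"
    by (rule infsum_cong) (auto simp: quad_def G_def case_prod_unfold)
  finally have eq: "quad a l x x = (\<Sum>\<^sub>\<infinity>(n, p). quad a l (V n) (V p))" .
  have "(\<lambda>(np, jk). G (jk, np)) summable_on UNIV \<times> UNIV"
    using Gs summable_on_swap[of G UNIV UNIV] by simp
  from summable_on_Sigma_banach[OF this]
  have "(\<lambda>(n, p). quad a l (V n) (V p)) summable_on UNIV"
    by (simp add: quad_def G_def case_prod_unfold)
  from has_sum_antidiagonal[OF this] show ?thesis by (simp add: eq)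
qed

end

locale simple_first_mode = bounded_coeffs +
  fixes c :: real
  assumes a1_pos: "a 1 > 0" and c_pos: "c > 0"
    and gap: "\<And>l. l > 1 \<Longrightarrow> c \<le> \<bar>a 1 - a l\<bar>"
begin

abbreviation U :: "nat \<Rightarrow> nat \<Rightarrow> real" where "U \<equiv> branch_coeff a"

text \<open>
  \<open>3 * C\<close> is the bound of the quadratic part and \<open>1 / c\<close> that of the inverse of the linear
  part; \<open>\<rho>\<close> is the largest radius allowed by \<open>majorant_sum_le\<close>.
\<close>
definition H :: real where "H = 3 * C / c"
definition \<rho> :: real where "\<rho> = 1 / (12 * H)"

lemma H_pos: "H > 0" using C_pos c_pos by (simp add: H_def)
lemma \<rho>_pos: "\<rho> > 0" using H_pos by (simp add: \<rho>_def)

lemma U_0 [simp]: "U n 0 = 0" by (cases n) (auto simp: unit_seq_def)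
lemma U_1: "U n 1 = 0 ^ n" by (cases n) (auto simp: unit_seq_def)

text \<open>
  The division by \<open>l * (a 1 - a l)\<close> gains the weight \<open>l\<close>: the quadratic terms are estimated by
  the \<open>\<ell>\<^sup>1\<close> norms of their factors, which the weighted norms dominate, and in the cubic terms only
  the last factor keeps its weight. The recursion of the majorant results.
\<close>
lemma U_weighted_bound:
  assumes "finite F"
  shows "(\<Sum>l\<in>F. real l * \<bar>U n l\<bar>) \<le> majorant H n"
  using assms
proof (induction n arbitrary: F rule: less_induct)
  case (less n)
  show ?case
  proof (cases n)
    case 0
    have "(\<Sum>l\<in>F. real l * \<bar>U n l\<bar>) = (\<Sum>l\<in>F. if l = 1 then 1 else 0)"
      by (intro sum.cong) (auto simp: 0 unit_seq_def)
    then show ?thesis using less.prems by (simp add: 0)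
  next
    case (Suc n')
    have U: "U i \<in> ell1" "l1norm (U i) \<le> majorant H i" if "i \<le> n'" for i
    proof -
      have "(\<Sum>l\<in>F. \<bar>U i l\<bar>) \<le> majorant H i" if F: "finite F" "0 \<notin> F" for F
      proof -
        have "(\<Sum>l\<in>F. \<bar>U i l\<bar>) \<le> (\<Sum>l\<in>F. real l * \<bar>U i l\<bar>)"
          using F by (intro sum_mono) (auto simp: mult_le_cancel_right1 Suc_le_eq intro!: gr0I)
        also have "\<dots> \<le> majorant H i" using less.IH[of i F] Suc \<open>i \<le> n'\<close> F by simp
        finally show ?thesis .
      qed
      then show "U i \<in> ell1" "l1norm (U i) \<le> majorant H i"
        using ell1_of_finite_bound[of "U i" "majorant H i"] by auto
    qed
    have NN: "3 * C * l1norm (U i) * l1norm (U k) \<le> 3 * C * (majorant H i * majorant H k)"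
      if "i \<le> n'" "k \<le> n'" for i k
      using U[OF that(1)] U[OF that(2)] C_pos l1norm_nonneg majorant_nonneg H_pos
      unfolding mult.assoc by (intro mult_left_mono mult_mono) auto
    define q where "q l i = quad a l (U i) (U (n' - i))" for l i
    define m where "m i = (\<Sum>k\<le>i. quad a 1 (U k) (U (i - k)))" for i
    have m: "\<bar>m i\<bar> \<le> 3 * C * (\<Sum>k\<le>i. majorant H k * majorant H (i - k))" if i: "i \<le> n'" for i
    proof -
      have "\<bar>m i\<bar> \<le> (\<Sum>k\<le>i. 3 * C * (majorant H k * majorant H (i - k)))"
        unfolding m_def
      proof (rule order_trans[OF sum_abs sum_mono])
        fix k assume "k \<in> {..i}"
        then have k: "k \<le> n'" "i - k \<le> n'" using i by auto
        show "\<bar>quad a 1 (U k) (U (i - k))\<bar> \<le> 3 * C * (majorant H k * majorant H (i - k))"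
          using abs_quad_le[OF U(1)[OF k(1)] U(1)[OF k(2)]] NN[OF k] by (rule order_trans)
      qed
      then show ?thesis by (simp add: sum_distrib_left)
    qed
    have "c * (\<Sum>l\<in>F. real l * \<bar>U n l\<bar>)
        \<le> (\<Sum>l\<in>F. (\<Sum>i\<le>n'. \<bar>q l i\<bar>) + (\<Sum>i\<le>n'. \<bar>m i\<bar> * (real l * \<bar>U (n' - i) l\<bar>)))"
      unfolding sum_distrib_left
    proof (rule sum_mono)
      fix l
      have rhs: "0 \<le> (\<Sum>i\<le>n'. \<bar>q l i\<bar>) + (\<Sum>i\<le>n'. \<bar>m i\<bar> * (real l * \<bar>U (n' - i) l\<bar>))"
        by (intro add_nonneg_nonneg sum_nonneg) auto
      show "c * (real l * \<bar>U n l\<bar>) \<le> (\<Sum>i\<le>n'. \<bar>q l i\<bar>) + (\<Sum>i\<le>n'. \<bar>m i\<bar> * (real l * \<bar>U (n' - i) l\<bar>))"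
      proof (cases "l \<le> 1")
        case False
        then have l: "l > 1" by simp
        have "a 1 - a l \<noteq> 0" using gap[OF l] c_pos by auto
        then have e: "real l * (a 1 - a l) * U n l = (\<Sum>i\<le>n'. q l i) - real l * (\<Sum>i\<le>n'. m i * U (n' - i) l)"
          using l by (simp add: Suc q_def m_def)
        have "c * (real l * \<bar>U n l\<bar>) \<le> \<bar>a 1 - a l\<bar> * (real l * \<bar>U n l\<bar>)"
          using gap[OF l] by (intro mult_right_mono) auto
        also have "\<dots> = \<bar>real l * (a 1 - a l) * U n l\<bar>" by (simp add: abs_mult)
        also have "\<dots> \<le> \<bar>\<Sum>i\<le>n'. q l i\<bar> + \<bar>\<Sum>i\<le>n'. m i * (real l * U (n' - i) l)\<bar>"
          unfolding e using abs_triangle_ineq4 by (simp add: sum_distrib_left mult_ac)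
        also have "\<dots> \<le> (\<Sum>i\<le>n'. \<bar>q l i\<bar>) + (\<Sum>i\<le>n'. \<bar>m i * (real l * U (n' - i) l)\<bar>)"
          by (intro add_mono sum_abs)
        finally show ?thesis by (simp add: abs_mult)
      qed (use rhs in \<open>simp add: Suc\<close>)
    qed
    also have "\<dots> = (\<Sum>i\<le>n'. \<Sum>l\<in>F. \<bar>q l i\<bar>) + (\<Sum>i\<le>n'. \<bar>m i\<bar> * (\<Sum>l\<in>F. real l * \<bar>U (n' - i) l\<bar>))"
      unfolding sum.distrib sum_distrib_left by (intro arg_cong2[of _ _ _ _ "(+)"] sum.swap)
    also have "\<dots> \<le> (\<Sum>i\<le>n'. 3 * C * (majorant H i * majorant H (n' - i)))
        + (\<Sum>i\<le>n'. (3 * C * (\<Sum>k\<le>i. majorant H k * majorant H (i - k))) * majorant H (n' - i))"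
    proof (intro add_mono sum_mono)
      fix i assume "i \<in> {..n'}"
      then have i: "i \<le> n'" by simp
      show "(\<Sum>l\<in>F. \<bar>q l i\<bar>) \<le> 3 * C * (majorant H i * majorant H (n' - i))"
        unfolding q_def using U[of i] U[of "n' - i"] i less.prems
        by (intro order_trans[OF quad_bound NN]) auto
      show "\<bar>m i\<bar> * (\<Sum>l\<in>F. real l * \<bar>U (n' - i) l\<bar>)
          \<le> (3 * C * (\<Sum>k\<le>i. majorant H k * majorant H (i - k))) * majorant H (n' - i)"
        using m[OF i] less.IH[of "n' - i" F] less.prems Suc C_pos H_pos
        by (intro mult_mono mult_nonneg_nonneg sum_nonneg) (auto simp: majorant_nonneg)
    qed
    also have "\<dots> = c * majorant H n"
      using c_pos by (simp add: Suc H_def sum_distrib_left[symmetric] mult.assoc distrib_left)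
    finally show ?thesis using c_pos by simp
  qed
qed

lemma U_series_bound:
  "(\<lambda>(n, l). real l * \<bar>U n l\<bar> * \<rho> ^ n) summable_on UNIV"
  "(\<Sum>\<^sub>\<infinity>(n, l). real l * \<bar>U n l\<bar> * \<rho> ^ n) \<le> 2"
proof -
  have "(\<Sum>(n, l)\<in>P. real l * \<bar>U n l\<bar> * \<rho> ^ n) \<le> 2" if P: "finite P" for P
  proof -
    obtain N where N: "fst ` P \<subseteq> {..N}"
      using P finite_nat_iff_bounded_le[of "fst ` P"] by auto
    have "(\<Sum>(n, l)\<in>P. real l * \<bar>U n l\<bar> * \<rho> ^ n) \<le> (\<Sum>(n, l)\<in>{..N} \<times> snd ` P. real l * \<bar>U n l\<bar> * \<rho> ^ n)"
      using P N \<rho>_pos by (intro sum_mono2) (force simp: image_iff)+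
    also have "\<dots> = (\<Sum>n\<le>N. (\<Sum>l\<in>snd ` P. real l * \<bar>U n l\<bar>) * \<rho> ^ n)"
      by (simp add: sum.cartesian_product[symmetric] sum_distrib_right)
    also have "\<dots> \<le> (\<Sum>n\<le>N. majorant H n * \<rho> ^ n)"
      using P \<rho>_pos by (intro sum_mono mult_right_mono U_weighted_bound) auto
    also have "\<dots> \<le> 2"
      using H_pos \<rho>_pos by (intro majorant_sum_le) (auto simp: \<rho>_def)
    finally show ?thesis .
  qed
  then show "(\<lambda>(n, l). real l * \<bar>U n l\<bar> * \<rho> ^ n) summable_on UNIV"
    "(\<Sum>\<^sub>\<infinity>(n, l). real l * \<bar>U n l\<bar> * \<rho> ^ n) \<le> 2"
    using summable_on_of_finite_bound[of UNIV "\<lambda>(n, l). real l * \<bar>U n l\<bar> * \<rho> ^ n" 2] \<rho>_pos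
    by auto
qed

text \<open>
  The profile \<open>u\<close>, the branch \<open>s * u\<close>, its increments and its deviation from \<open>s * e\<^sub>1\<close> are all
  series in the coefficient sequences, with scalars of size at most \<open>K * \<rho> ^ n\<close>, so that \<open>comb_bound\<close> estimates all of them at once.
\<close>
definition comb :: "(nat \<Rightarrow> real) \<Rightarrow> nat \<Rightarrow> real" where
  "comb w = (\<lambda>l. \<Sum>\<^sub>\<infinity>n. U n l * w n)"

lemma comb_terms_summable:
  assumes w: "\<And>n. \<bar>w n\<bar> \<le> K * \<rho> ^ n"
  shows "(\<lambda>(n, l). U n l * w n) summable_on UNIV" "(\<lambda>n. U n l * w n) summable_on UNIV"
proof -
  have K: "K \<ge> 0" using w[of 0] by simp
  show *: "(\<lambda>(n, l). U n l * w n) summable_on UNIV"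
  proof (rule summable_on_real_comparison)
    show "(\<lambda>p. K * (case p of (n, l) \<Rightarrow> real l * \<bar>U n l\<bar> * \<rho> ^ n)) summable_on UNIV"
      by (intro summable_on_cmult_right U_series_bound)
    fix p :: "nat \<times> nat"
    obtain n l where p: "p = (n, l)" by (cases p)
    have "\<bar>U n l\<bar> \<le> real l * \<bar>U n l\<bar>" by (cases l) (auto simp: mult_le_cancel_right1)
    then have "\<bar>U n l\<bar> * \<bar>w n\<bar> \<le> real l * \<bar>U n l\<bar> * (K * \<rho> ^ n)"
      using w K \<rho>_pos by (intro mult_mono) auto
    then show "\<bar>case p of (n, l) \<Rightarrow> U n l * w n\<bar> \<le> K * (case p of (n, l) \<Rightarrow> real l * \<bar>U n l\<bar> * \<rho> ^ n)"
      by (simp add: p abs_mult mult_ac)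
  qed
  have "(\<lambda>(l, n). U n l * w n) summable_on UNIV \<times> UNIV"
    using * summable_on_swap[of "\<lambda>(n, l). U n l * w n" UNIV UNIV] by simp
  then show "(\<lambda>n. U n l * w n) summable_on UNIV"
    by (rule summable_on_SigmaD1) simp
qed

lemma comb_bound:
  assumes w: "\<And>n. \<bar>w n\<bar> \<le> K * \<rho> ^ n"
  shows "comb w \<in> ell2w" "wnorm (comb w) \<le> 4 * K"
proof -
  have K: "K \<ge> 0" using w[of 0] by simp
  have "(\<Sum>l\<in>F. real l * \<bar>comb w l\<bar>) \<le> 2 * K" if F: "finite F" for F
  proof -
    let ?B = "\<lambda>n l. real l * \<bar>U n l\<bar> * \<rho> ^ n"
    have Bs: "(\<lambda>n. ?B n l) summable_on UNIV" for l
    proof -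
      have "(\<lambda>(l, n). ?B n l) summable_on UNIV \<times> UNIV"
        using U_series_bound(1) summable_on_swap[of "\<lambda>(n, l). ?B n l" UNIV UNIV] by simp
      then show ?thesis by (rule summable_on_SigmaD1) simp
    qed
    have swap: "(\<lambda>(l, n). ?B n l) summable_on UNIV \<times> UNIV"
      using U_series_bound(1) summable_on_swap[of "\<lambda>(n, l). ?B n l" UNIV UNIV] by simp
    have "(\<Sum>l\<in>F. real l * \<bar>comb w l\<bar>) \<le> (\<Sum>l\<in>F. K * (\<Sum>\<^sub>\<infinity>n. ?B n l))"
    proof (rule sum_mono)
      fix l
      have "real l * \<bar>comb w l\<bar> = \<bar>\<Sum>\<^sub>\<infinity>n. real l * (U n l * w n)\<bar>"
        by (simp add: comb_def infsum_cmult_right' abs_mult)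
      also have "\<dots> \<le> (\<Sum>\<^sub>\<infinity>n. K * ?B n l)"
      proof (rule abs_infsum_le)
        show "(\<lambda>n. K * ?B n l) summable_on UNIV" by (intro summable_on_cmult_right Bs)
        show "\<bar>real l * (U n l * w n)\<bar> \<le> K * ?B n l" for n
          using mult_left_mono[OF w[of n], of "real l * \<bar>U n l\<bar>"] by (simp add: abs_mult mult_ac)
      qed
      finally show "real l * \<bar>comb w l\<bar> \<le> K * (\<Sum>\<^sub>\<infinity>n. ?B n l)" by (simp add: infsum_cmult_right')
    qed
    also have "\<dots> = K * (\<Sum>l\<in>F. \<Sum>\<^sub>\<infinity>n. ?B n l)" by (simp add: sum_distrib_left)
    also have "\<dots> \<le> K * 2"
    proof (rule mult_left_mono[OF _ K])
      have "(\<Sum>l\<in>F. \<Sum>\<^sub>\<infinity>n. ?B n l) \<le> (\<Sum>\<^sub>\<infinity>l. \<Sum>\<^sub>\<infinity>n. ?B n l)"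
      using \<rho>_pos F by (intro finite_sum_le_infsum summable_on_Sigma_banach[OF swap] infsum_nonneg) auto
    also have "\<dots> = (\<Sum>\<^sub>\<infinity>n. \<Sum>\<^sub>\<infinity>l. ?B n l)" by (rule infsum_swap_banach[OF swap])
    also have "\<dots> = (\<Sum>\<^sub>\<infinity>(n, l). ?B n l)"
      using infsum_Sigma'_banach[of ?B UNIV "\<lambda>_. UNIV"] U_series_bound(1) by simp
    also have "\<dots> \<le> 2" by (rule U_series_bound(2))
    finally show "(\<Sum>l\<in>F. \<Sum>\<^sub>\<infinity>n. ?B n l) \<le> 2" .
    qed
    finally show ?thesis by simp
  qed
  then show "comb w \<in> ell2w" "wnorm (comb w) \<le> 4 * K"
    using ell2w_of_weighted_sum[of "comb w" "2 * K"] by (auto simp: comb_def)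
qed

lemma comb_diff:
  assumes "\<And>n. \<bar>v n\<bar> \<le> K * \<rho> ^ n" "\<And>n. \<bar>w n\<bar> \<le> L * \<rho> ^ n"
  shows "comb v l - comb w l = comb (\<lambda>n. v n - w n) l"
proof -
  have "comb (\<lambda>n. v n - w n) l = (\<Sum>\<^sub>\<infinity>n. U n l * v n + - (U n l * w n))"
    by (simp add: comb_def right_diff_distrib)
  also have "\<dots> = comb v l + - comb w l"
    unfolding comb_def infsum_uminus[symmetric]
    by (intro infsum_add comb_terms_summable(2)[OF assms(1)]
        summable_on_uminus[THEN iffD2] comb_terms_summable(2)[OF assms(2)])
  finally show ?thesis by simp
qed

text \<open>
  \<open>M s\<close> is \<open>Q 1 u u\<close>, expanded in powers of \<open>s\<close>; the parameter on the branch is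
  \<open>2 / \<kappa> = a 1 + s * M s\<close>.
\<close>
definition M_coeff :: "nat \<Rightarrow> real" where
  "M_coeff n = (\<Sum>i\<le>n. quad a 1 (U i) (U (n - i)))"

definition M :: "real \<Rightarrow> real" where "M s = (\<Sum>n. M_coeff n * s ^ n)"

definition profile :: "real \<Rightarrow> nat \<Rightarrow> real" where "profile s = comb (\<lambda>n. s ^ n)"

lemma abs_power_le: "\<bar>s\<bar> \<le> \<rho> \<Longrightarrow> \<bar>s ^ n\<bar> \<le> 1 * \<rho> ^ n"
  by (simp add: power_abs power_mono)

lemma
  assumes s: "\<bar>s\<bar> \<le> \<rho>"
  shows profile_ell2w: "profile s \<in> ell2w" and profile_bound: "wnorm (profile s) \<le> 4"
    and profile_has_sum: "((\<lambda>n. U n l * s ^ n) has_sum profile s l) UNIV"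
  using comb_bound[OF abs_power_le[OF s]] comb_terms_summable(2)[OF abs_power_le[OF s], of l]
  by (simp_all add: profile_def comb_def)

lemmas profile_ell1 = ell2w_imp_ell1(1)[OF profile_ell2w]

lemma quad_profile_has_sum:
  assumes s: "\<bar>s\<bar> \<le> \<rho>"
  shows "((\<lambda>n. (\<Sum>i\<le>n. quad a l (U i) (U (n - i))) * s ^ n) has_sum quad a l (profile s) (profile s)) UNIV"
proof -
  have "(\<lambda>(n, j). U n j * s ^ n) summable_on UNIV"
    by (rule comb_terms_summable(1)[OF abs_power_le[OF s]])
  from quad_series[OF this, of l]
  have "((\<lambda>n. \<Sum>i\<le>n. quad a l (U i) (U (n - i)) * (s ^ i * s ^ (n - i))) has_sum quad a l (profile s) (profile s)) UNIV"
    by (simp add: quad_scale profile_def comb_def)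
  moreover have "(\<Sum>i\<le>n. quad a l (U i) (U (n - i)) * (s ^ i * s ^ (n - i)))
      = (\<Sum>i\<le>n. quad a l (U i) (U (n - i))) * s ^ n" for n
    unfolding sum_distrib_right by (intro sum.cong refl) (simp flip: power_add)
  ultimately show ?thesis by simp
qed

lemma M_has_sum: "\<bar>s\<bar> \<le> \<rho> \<Longrightarrow> ((\<lambda>n. M_coeff n * s ^ n) has_sum M s) UNIV"
  and quad_1_profile: "\<bar>s\<bar> \<le> \<rho> \<Longrightarrow> quad a 1 (profile s) (profile s) = M s"
proof -
  assume s: "\<bar>s\<bar> \<le> \<rho>"
  have *: "((\<lambda>n. M_coeff n * s ^ n) has_sum quad a 1 (profile s) (profile s)) UNIV"
    unfolding M_coeff_def by (rule quad_profile_has_sum[OF s])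
  then show "quad a 1 (profile s) (profile s) = M s"
    unfolding M_def by (rule sums_unique[OF has_sum_imp_sums])
  then show "((\<lambda>n. M_coeff n * s ^ n) has_sum M s) UNIV" using * by simp
qed

text \<open>
  For \<open>l = 1\<close> this is the choice of \<open>M\<close>. For \<open>l \<ge> 2\<close> it is the recursion of the
  coefficients, multiplied by \<open>s ^ Suc n\<close> and summed: the convolutions in it become products of
  the series.
\<close>
lemma profile_equation:
  assumes s: "\<bar>s\<bar> \<le> \<rho>" and l: "l \<ge> 1"
  shows "real l * (a 1 + s * M s - a l) * profile s l = s * quad a l (profile s) (profile s)"
proof (cases "l = 1")
  case True
  have "((\<lambda>n. U n 1 * s ^ n) has_sum 1) UNIV"
  proof (rule has_sum_finite_neutralI[of "{0}"])
    show "U n 1 * s ^ n = 0" if "n \<in> UNIV - {0}" for n using that by (simp add: U_1 flip: One_nat_def)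
  qed (auto simp: unit_seq_def)
  then have "profile s 1 = 1" using profile_has_sum[OF s, of 1] has_sum_unique by blast
  then show ?thesis using quad_1_profile[OF s] True by simp
next
  case False
  then have l: "l > 1" using l by simp
  have gap': "a 1 - a l \<noteq> 0" using gap[OF l] c_pos by auto
  define q where "q n = (\<Sum>i\<le>n. quad a l (U i) (U (n - i)))" for n
  define w where "w n = (\<Sum>i\<le>n. M_coeff i * U (n - i) l)" for n
  have q: "((\<lambda>n. q n * s ^ n) has_sum quad a l (profile s) (profile s)) UNIV"
    unfolding q_def by (rule quad_profile_has_sum[OF s])
  have w: "((\<lambda>n. w n * s ^ n) has_sum M s * profile s l) UNIV"
  proof -
    have sm: "(\<lambda>n. M_coeff n * s ^ n) summable_on UNIV" "(\<lambda>n. U n l * s ^ n) summable_on UNIV"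
      using M_has_sum[OF s] profile_has_sum[OF s] has_sum_imp_summable by blast+
    have "infsum (\<lambda>(i, k). (M_coeff i * s ^ i) * (U k l * s ^ k)) UNIV = M s * profile s l"
      using infsum_times[OF sm] infsumI[OF M_has_sum[OF s]] infsumI[OF profile_has_sum[OF s, of l]] by simp
    with has_sum_antidiagonal[of "\<lambda>(i, k). (M_coeff i * s ^ i) * (U k l * s ^ k)"] summable_on_times[OF sm]
    have "((\<lambda>n. \<Sum>i\<le>n. (M_coeff i * s ^ i) * (U (n - i) l * s ^ (n - i))) has_sum M s * profile s l) UNIV" by simp
    moreover have "(\<Sum>i\<le>n. (M_coeff i * s ^ i) * (U (n - i) l * s ^ (n - i))) = w n * s ^ n" for n
    proof -
      have "s ^ i * s ^ (n - i) = s ^ n" if "i \<le> n" for i using that by (simp flip: power_add)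
      then show ?thesis
        unfolding w_def sum_distrib_right by (intro sum.cong refl) (metis (no_types, lifting) atMost_iff mult.assoc mult.left_commute)
    qed
    ultimately show ?thesis by simp
  qed
  let ?D = "real l * (a 1 - a l)"
  have rearrange: "D * v = s * E" if "v = s / D * E" "D \<noteq> 0" for v D E :: real using that by simp
  have rec: "U (Suc n) l = (q n - real l * w n) / ?D" for n
    using l by (simp add: q_def w_def M_coeff_def)
  have "((\<lambda>n. s / ?D * (q n * s ^ n + - (real l * (w n * s ^ n)))) has_sum
      s / ?D * (quad a l (profile s) (profile s) + - (real l * (M s * profile s l)))) UNIV"
    by (intro has_sum_cmult_right has_sum_add q has_sum_uminusI w)
  moreover have "s / ?D * (q n * s ^ n + - (real l * (w n * s ^ n))) = U (Suc n) l * s ^ Suc n" for n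
  proof -
    have "s / D * (x * z + - (L * (y * z))) = (x - L * y) / D * (s * z)" for D x y z L :: real
      by (simp add: divide_inverse algebra_simps)
    then show ?thesis unfolding rec power_Suc .
  qed
  ultimately have "((\<lambda>n. U (Suc n) l * s ^ Suc n) has_sum
      s / ?D * (quad a l (profile s) (profile s) + - (real l * (M s * profile s l)))) UNIV" by (simp only:)
  then have "(\<lambda>n. U (Suc n) l * s ^ Suc n) sums (s / ?D * (quad a l (profile s) (profile s) + - (real l * (M s * profile s l))))"
    by (rule has_sum_imp_sums)
  then have "(\<lambda>n. U n l * s ^ n) sums (s / ?D * (quad a l (profile s) (profile s) + - (real l * (M s * profile s l))) + U 0 l * s ^ 0)"
    by (rule sums_Suc)
  with has_sum_imp_sums[OF profile_has_sum[OF s]]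
  have "profile s l = s / ?D * (quad a l (profile s) (profile s) + - (real l * (M s * profile s l))) + U 0 l * s ^ 0"
    by (rule sums_unique2)
  moreover have "U 0 l = 0" using l by (simp add: unit_seq_def)
  ultimately have "profile s l = s / ?D * (quad a l (profile s) (profile s) - real l * (M s * profile s l))" by simp
  moreover have "?D \<noteq> 0" using gap' l by simp
  ultimately have "?D * profile s l = s * (quad a l (profile s) (profile s) - real l * (M s * profile s l))"
    by (rule rearrange)
  then show ?thesis by (simp add: algebra_simps)
qed

text \<open>
  \<open>\<rho> / 2\<close> makes the branch Lipschitz continuous (\<open>abs_power_diff_le\<close>). The second bound keeps
  \<open>\<bar>s * M s\<bar>\<close> at most \<open>a 1 / 2\<close>, hence \<open>\<kappa>\<close> positive: \<open>4 * embedding_const\<close> bounds the \<open>\<ell>\<^sup>1\<close> norm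
  of the profile.
\<close>
definition branch_length :: real where
  "branch_length = min (\<rho> / 2) (a 1 / (2 * (1 + 3 * C * (4 * embedding_const)\<^sup>2)))"

lemma branch_length_pos: "branch_length > 0"
  using \<rho>_pos a1_pos C_pos by (auto simp: branch_length_def intro!: divide_pos_pos add_pos_nonneg)

definition branch :: "real \<Rightarrow> nat \<Rightarrow> real" where "branch s = comb (\<lambda>n. s ^ Suc n)"
definition branch_\<kappa> :: "real \<Rightarrow> real" where "branch_\<kappa> s = 2 / (a 1 + s * M s)"

lemma branch_eq: "branch s = (\<lambda>l. profile s l * s)"
  unfolding branch_def profile_def comb_def infsum_cmult_left'[symmetric] power_Suc2 mult.assoc ..

lemma denominator_pos:
  assumes s: "\<bar>s\<bar> \<le> branch_length"
  shows "a 1 + s * M s > 0"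
proof -
  let ?B = "3 * C * (4 * embedding_const)\<^sup>2"
  have B: "?B \<ge> 0" using C_pos by simp
  have s\<rho>: "\<bar>s\<bar> \<le> \<rho>" using s \<rho>_pos by (simp add: branch_length_def)
  have N: "l1norm (profile s) \<le> 4 * embedding_const"
  proof -
    from ell2w_imp_ell1(2)[OF profile_ell2w[OF s\<rho>]] have "l1norm (profile s) \<le> embedding_const * wnorm (profile s)" .
    also have "\<dots> \<le> embedding_const * 4"
      using profile_bound[OF s\<rho>] embedding_const_pos by (intro mult_left_mono) auto
    finally show ?thesis by simp
  qed
  have "\<bar>M s\<bar> \<le> 3 * C * l1norm (profile s) * l1norm (profile s)"
    using abs_quad_le[OF profile_ell1[OF s\<rho>] profile_ell1[OF s\<rho>], of 1] quad_1_profile[OF s\<rho>] by simp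
  also have "\<dots> \<le> ?B"
    unfolding power2_eq_square mult.assoc
    using mult_mono[OF N N] C_pos l1norm_nonneg embedding_const_pos by (simp add: mult.assoc)
  finally have "\<bar>s\<bar> * \<bar>M s\<bar> \<le> a 1 / (2 * (1 + ?B)) * (1 + ?B)"
    using s a1_pos B by (intro mult_mono) (auto simp: branch_length_def)
  also have "\<dots> = a 1 / 2"
  proof -
    have "x / (2 * y) * y = x / 2" if "y > 0" for x y :: real using that by simp
    then show ?thesis using B by (simp only: add_pos_nonneg zero_less_one)
  qed
  finally have "\<bar>s * M s\<bar> \<le> a 1 / 2" by (simp add: abs_mult)
  then show ?thesis using a1_pos unfolding abs_le_iff by linarith
qed

lemma branch_zero:
  assumes s: "\<bar>s\<bar> \<le> branch_length"
  shows "MV_zero a (branch s) (branch_\<kappa> s)"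
proof -
  have s\<rho>: "\<bar>s\<bar> \<le> \<rho>" using s \<rho>_pos by (simp add: branch_length_def)
  have e: "branch s \<in> ell1"
    using profile_ell1[OF s\<rho>] by (auto simp: branch_eq ell1_def intro: summable_on_cmult_left)
  have k: "branch_\<kappa> s > 0" using denominator_pos[OF s] by (simp add: branch_\<kappa>_def)
  have "2 / branch_\<kappa> s = a 1 + s * M s" by (simp add: branch_\<kappa>_def)
  then show ?thesis
    unfolding MV_zero_iff[OF e k] unfolding branch_eq quad_scale
    using profile_equation[OF s\<rho>] by (simp only: mult.assoc[symmetric]) (simp add: mult_ac)
qed

text \<open>
  Expand the difference into \<open>Suc n\<close> products of \<open>n\<close> factors and use \<open>Suc n \<le> 2 ^ n\<close>.
\<close>
lemma abs_power_diff_le: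
  fixes r s t :: real
  assumes "\<bar>s\<bar> \<le> r" "\<bar>t\<bar> \<le> r"
  shows "\<bar>t ^ Suc n - s ^ Suc n\<bar> \<le> \<bar>t - s\<bar> * (2 * r) ^ n"
proof -
  have r: "r \<ge> 0" using assms by simp
  have "t ^ Suc n - s ^ Suc n = (t - s) * (\<Sum>i<Suc n. s ^ (Suc n - Suc i) * t ^ i)"
    by (rule power_diff_sumr2)
  moreover have "\<bar>\<Sum>i<Suc n. s ^ (Suc n - Suc i) * t ^ i\<bar> \<le> (\<Sum>i<Suc n. r ^ n)"
  proof (rule order_trans[OF sum_abs sum_mono])
    fix i assume "i \<in> {..<Suc n}"
    then have "r ^ n = r ^ (n - i) * r ^ i" by (simp flip: power_add)
    then show "\<bar>s ^ (Suc n - Suc i) * t ^ i\<bar> \<le> r ^ n"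
      using assms r by (auto simp: abs_mult power_abs intro!: mult_mono power_mono)
  qed
  moreover have "(\<Sum>i<Suc n. r ^ n) \<le> 2 ^ n * r ^ n"
  proof -
    have "Suc n \<le> 2 ^ n" by (simp add: Suc_le_eq)
    then have "real (Suc n) \<le> 2 ^ n" by (metis of_nat_le_iff of_nat_numeral of_nat_power)
    then show ?thesis using r by (simp add: mult_right_mono)
  qed
  ultimately show ?thesis
    by (simp add: abs_mult power_mult_distrib mult_left_mono)
qed

lemma branch_ell2w: "\<bar>s\<bar> \<le> \<rho> \<Longrightarrow> branch s \<in> ell2w"
proof -
  assume s: "\<bar>s\<bar> \<le> \<rho>"
  have "\<bar>s ^ Suc n\<bar> \<le> \<bar>s\<bar> * \<rho> ^ n" for n
    using abs_power_le[OF s, of n] by (simp add: abs_mult mult_left_mono)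
  then show "branch s \<in> ell2w" unfolding branch_def by (rule comb_bound(1))
qed

lemma branch_lipschitz:
  assumes "\<bar>s\<bar> \<le> \<rho> / 2" "\<bar>t\<bar> \<le> \<rho> / 2"
  shows "wnorm (\<lambda>l. branch t l - branch s l) \<le> 4 * \<bar>t - s\<bar>"
proof -
  have b: "\<bar>r ^ Suc n\<bar> \<le> \<bar>r\<bar> * \<rho> ^ n" if "\<bar>r\<bar> \<le> \<rho> / 2" for r n
    using abs_power_le[of r n] that \<rho>_pos by (simp add: abs_mult mult_left_mono)
  have "(\<lambda>l. branch t l - branch s l) = comb (\<lambda>n. t ^ Suc n - s ^ Suc n)"
    unfolding branch_def using comb_diff[OF b[OF assms(2)] b[OF assms(1)]] by blast
  moreover have "\<bar>t ^ Suc n - s ^ Suc n\<bar> \<le> \<bar>t - s\<bar> * \<rho> ^ n" for n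
    using abs_power_diff_le[OF assms, of n] by simp
  ultimately show ?thesis by (simp only: comb_bound(2))
qed

lemma branch_tangent:
  assumes s: "\<bar>s\<bar> \<le> \<rho>"
  shows "wnorm (\<lambda>l. branch s l - s * unit_seq 1 l) \<le> 4 * (s\<^sup>2 / \<rho>)"
proof -
  have b: "\<bar>s ^ Suc n\<bar> \<le> \<bar>s\<bar> * \<rho> ^ n" "\<bar>s * 0 ^ n\<bar> \<le> \<bar>s\<bar> * \<rho> ^ n" for n
    using abs_power_le[OF s, of n] \<rho>_pos by (auto simp: abs_mult mult_left_mono power_0_left)
  have "comb (\<lambda>n. s * 0 ^ n) l = s * unit_seq 1 l" for l
  proof -
    have "((\<lambda>n. U n l * (s * 0 ^ n)) has_sum s * unit_seq 1 l) UNIV"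
      by (rule has_sum_finite_neutralI[of "{0}"]) auto
    then show ?thesis by (simp add: comb_def infsumI)
  qed
  then have "(\<lambda>l. branch s l - s * unit_seq 1 l) = comb (\<lambda>n. s ^ Suc n - s * 0 ^ n)"
    unfolding branch_def using comb_diff[OF b(1) b(2)] by simp
  moreover have "\<bar>s ^ Suc n - s * 0 ^ n\<bar> \<le> s\<^sup>2 / \<rho> * \<rho> ^ n" for n
  proof (cases n)
    case (Suc k)
    have "\<bar>s ^ Suc n\<bar> = s\<^sup>2 * \<bar>s ^ k\<bar>" by (simp add: Suc abs_mult power2_eq_square)
    also have "\<dots> \<le> s\<^sup>2 * \<rho> ^ k" using abs_power_le[OF s, of k] by (intro mult_left_mono) auto
    finally show ?thesis using \<rho>_pos by (simp add: Suc)
  qed (use \<rho>_pos in simp)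
  ultimately show ?thesis by (simp only: comb_bound(2))
qed

lemma M_smooth:
  obtains M' M'' where "\<And>s. \<bar>s\<bar> < \<rho> \<Longrightarrow> (M has_real_derivative M' s) (at s)"
    "\<And>s. \<bar>s\<bar> < \<rho> \<Longrightarrow> (M' has_real_derivative M'' s) (at s)"
proof -
  have sm: "summable (\<lambda>n. M_coeff n * z ^ n)" if "norm z < \<rho>" for z
    using M_has_sum[of z] that by (auto dest!: has_sum_imp_sums sums_summable)
  show ?thesis
  proof (rule that)
    show "(M has_real_derivative (\<Sum>n. diffs M_coeff n * s ^ n)) (at s)" if "\<bar>s\<bar> < \<rho>" for s
      unfolding M_def using that sm by (intro termdiffs_strong') auto
    show "((\<lambda>s. \<Sum>n. diffs M_coeff n * s ^ n) has_real_derivative (\<Sum>n. diffs (diffs M_coeff) n * s ^ n)) (at s)"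
      if "\<bar>s\<bar> < \<rho>" for s
      using that termdiff_converges[OF _ sm] by (intro termdiffs_strong'[where K = \<rho>]) auto
  qed
qed

text \<open>
  \<open>M 0\<close> is the action of the first mode on itself at the first mode, and neither \<open>1 + 1 = 1\<close> nor
  \<open>1 - 1 = 1\<close>.
\<close>
lemma M_0: "M 0 = 0"
proof -
  have "coupling a 1 j k * unit_seq 1 j * unit_seq 1 k = 0" for j k
    by (auto simp: coupling_def unit_seq_def)
  then have "(\<lambda>(j, k). coupling a 1 j k * unit_seq 1 j * unit_seq 1 k) = (\<lambda>_. 0)"
    by (auto simp only: split: prod.split)
  then have "M_coeff 0 = 0" by (simp add: M_coeff_def quad_def)
  then show ?thesis using powser_sums_zero[of M_coeff] by (simp add: M_def sums_iff)
qed

lemma first_mode_branch_exists: "first_mode_branch a (2 / a 1) branch_length branch branch_\<kappa>"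
proof -
  obtain M' M'' where M': "\<And>s. \<bar>s\<bar> < \<rho> \<Longrightarrow> (M has_real_derivative M' s) (at s)"
    and M'': "\<And>s. \<bar>s\<bar> < \<rho> \<Longrightarrow> (M' has_real_derivative M'' s) (at s)"
    using M_smooth by blast
  have inside: "\<bar>s\<bar> < \<rho>" "\<bar>s\<bar> \<le> \<rho> / 2" "\<bar>s\<bar> \<le> branch_length" if "s \<in> {- branch_length<..<branch_length}" for s
    using that \<rho>_pos by (auto simp: branch_length_def)
  define d where "d s = a 1 + s * M s" for s
  define d' where "d' s = M s + s * M' s" for s
  define d'' where "d'' s = 2 * M' s + s * M'' s" for s
  have d: "d s > 0" "(d has_real_derivative d' s) (at s)" "(d' has_real_derivative d'' s) (at s)"
    if "s \<in> {- branch_length<..<branch_length}" for s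
  proof -
    show "d s > 0" using denominator_pos inside[OF that] by (simp add: d_def)
    show "(d has_real_derivative d' s) (at s)"
      unfolding d_def d'_def using M'[OF inside(1)[OF that]] by (auto intro!: derivative_eq_intros)
    show "(d' has_real_derivative d'' s) (at s)"
      unfolding d'_def d''_def using M'[OF inside(1)[OF that]] M''[OF inside(1)[OF that]]
      by (auto intro!: derivative_eq_intros)
  qed
  define \<kappa>' where "\<kappa>' s = - 2 * d' s / (d s)\<^sup>2" for s
  have \<kappa>': "(branch_\<kappa> has_real_derivative \<kappa>' s) (at s)" if "s \<in> {- branch_length<..<branch_length}" for s
    unfolding branch_\<kappa>_def \<kappa>'_def d_def[symmetric]
    using d[OF that] by (auto intro!: derivative_eq_intros simp: power2_eq_square)
  have "\<exists>D. (\<kappa>' has_real_derivative D) (at s)" if "s \<in> {- branch_length<..<branch_length}" for s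
  proof -
    have "\<kappa>' field_differentiable at s"
      unfolding \<kappa>'_def using d[OF that]
      by (intro field_differentiable_divide field_differentiable_mult field_differentiable_power
          field_differentiable_const) (auto simp: field_differentiable_def)
    then show ?thesis by (simp add: field_differentiable_def)
  qed
  then obtain \<kappa>'' where \<kappa>'': "\<And>s. s \<in> {- branch_length<..<branch_length} \<Longrightarrow> (\<kappa>' has_real_derivative \<kappa>'' s) (at s)"
    by metis
  have \<kappa>'0: "\<kappa>' 0 = 0" by (simp add: \<kappa>'_def d'_def M_0)
  have first: "branch s 1 = s" if "s \<in> {- branch_length<..<branch_length}" for s
  proof -
    have "((\<lambda>n. U n 1 * s ^ Suc n) has_sum s) UNIV"
    proof (rule has_sum_finite_neutralI[of "{0}"])
      show "U n 1 * s ^ Suc n = 0" if "n \<in> UNIV - {0}" for n using that by (simp add: U_1 flip: One_nat_def)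
    qed (auto simp: unit_seq_def)
    then show ?thesis by (simp add: branch_def comb_def infsumI)
  qed
  have branch0: "branch 0 = (\<lambda>l. 0)" by (simp add: branch_eq)
  have cont: "((\<lambda>t. wnorm (\<lambda>l. branch t l - branch s l)) \<longlongrightarrow> 0) (at s within {- branch_length<..<branch_length})"
    if s: "s \<in> {- branch_length<..<branch_length}" for s
  proof (rule Lim_null_comparison)
    have "((\<lambda>t. 4 * \<bar>t - s\<bar>) \<longlongrightarrow> 4 * \<bar>s - s\<bar>) (at s within {- branch_length<..<branch_length})"
      by (intro tendsto_intros)
    then show "((\<lambda>t. 4 * \<bar>t - s\<bar>) \<longlongrightarrow> 0) (at s within {- branch_length<..<branch_length})" by simp
    have "norm (wnorm (\<lambda>l. branch t l - branch s l)) \<le> 4 * \<bar>t - s\<bar>" if t: "t \<in> {- branch_length<..<branch_length}" for t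
      using branch_lipschitz[OF inside(2)[OF s] inside(2)[OF t]] inside(1)[OF s] inside(1)[OF t]
        wnorm_nonneg[OF ell2w_diff[OF branch_ell2w branch_ell2w, of t s]] by simp
    then show "\<forall>\<^sub>F t in at s within {- branch_length<..<branch_length}. norm (wnorm (\<lambda>l. branch t l - branch s l)) \<le> 4 * \<bar>t - s\<bar>"
      by (simp add: eventually_at_filter)
  qed
  have "nontrivial_branch a (2 / a 1) branch_length branch branch_\<kappa>"
    unfolding nontrivial_branch_def
  proof (intro conjI ballI impI)
    show "0 < branch_length" by (rule branch_length_pos)
    show "continuous_on {- branch_length<..<branch_length} branch_\<kappa>"
      using \<kappa>' by (intro continuous_at_imp_continuous_on ballI DERIV_isCont) blast
    show "branch_\<kappa> 0 = 2 / a 1" by (simp add: branch_\<kappa>_def)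
    show "branch 0 = (\<lambda>l. 0)" by (rule branch0)
    fix s assume s: "s \<in> {- branch_length<..<branch_length}"
    show "branch s \<in> ell2w" using inside[OF s] by (intro branch_ell2w) simp
    show "0 < branch_\<kappa> s" using d(1)[OF s] by (simp add: branch_\<kappa>_def d_def)
    show "((\<lambda>t. wnorm (\<lambda>l. branch t l - branch s l)) \<longlongrightarrow> 0) (at s within {- branch_length<..<branch_length})" by (rule cont[OF s])
    show "MV_zero a (branch s) (branch_\<kappa> s)" by (rule branch_zero[OF inside(3)[OF s]])
    fix t assume t: "t \<in> {- branch_length<..<branch_length}" and "branch s = (\<lambda>l. 0) \<and> branch t = (\<lambda>l. 0)"
    then show "s = t" using first[OF s] first[OF t] by simp
  qed
  moreover have "((\<lambda>s. wnorm (\<lambda>l. branch s l - s * unit_seq 1 l) / \<bar>s\<bar>) \<longlongrightarrow> 0) (at 0)"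
  proof (rule Lim_null_comparison)
    have "((\<lambda>s. 4 / \<rho> * \<bar>s\<bar>) \<longlongrightarrow> 4 / \<rho> * \<bar>0\<bar>) (at 0)" by (intro tendsto_intros)
    then show "((\<lambda>s. 4 / \<rho> * \<bar>s\<bar>) \<longlongrightarrow> 0) (at 0)" by simp
    have "norm (wnorm (\<lambda>l. branch s l - s * unit_seq 1 l) / \<bar>s\<bar>) \<le> 4 / \<rho> * \<bar>s\<bar>"
      if "s \<noteq> 0" "dist s 0 < \<rho>" for s
    proof -
      have s: "\<bar>s\<bar> \<le> \<rho>" using that by simp
      have "wnorm (\<lambda>l. branch s l - s * unit_seq 1 l) \<ge> 0"
        by (intro wnorm_nonneg ell2w_diff branch_ell2w[OF s] unit_seq_ell2w) simp
      moreover have "wnorm (\<lambda>l. branch s l - s * unit_seq 1 l) / \<bar>s\<bar> \<le> 4 * (s\<^sup>2 / \<rho>) / \<bar>s\<bar>"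
        using branch_tangent[OF s] by (rule divide_right_mono) simp
      moreover have "4 * (s\<^sup>2 / \<rho>) / \<bar>s\<bar> = 4 / \<rho> * \<bar>s\<bar>"
        using that(1) \<rho>_pos by (simp add: field_simps power2_eq_square)
      ultimately show ?thesis by simp
    qed
    then show "\<forall>\<^sub>F s in at 0. norm (wnorm (\<lambda>l. branch s l - s * unit_seq 1 l) / \<bar>s\<bar>) \<le> 4 / \<rho> * \<bar>s\<bar>"
      using \<rho>_pos by (auto simp: eventually_at)
  qed
  ultimately show ?thesis
    unfolding first_mode_branch_def using \<kappa>' \<kappa>'' \<kappa>'0 by blast
qed

end


theorem theorem2p3:
  fixes W :: "real \<Rightarrow> real" and a :: "nat \<Rightarrow> real"
  assumes potential: "even_potential W a"
    and bounded: "bdd_above ((\<lambda>l. real l * \<bar>a l\<bar>) ` {1..})"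
  shows
    "(\<forall>m\<ge>1. a m > 0 \<and> (\<forall>l>1. a (l * m) \<noteq> a m) \<longrightarrow>
        (\<exists>\<delta> pm \<kappa>m. first_mode_branch (rescaled_coeffs m a) (2 / a m) \<delta> pm \<kappa>m) \<and>
        (\<forall>\<delta> pm \<kappa>m. first_mode_branch (rescaled_coeffs m a) (2 / a m) \<delta> pm \<kappa>m \<longrightarrow>
           locally_unique_branch (rescaled_coeffs m a) (2 / a m) \<delta> pm \<kappa>m \<and>
           (\<exists>p \<kappa>. nontrivial_branch a (2 / a m) \<delta> p \<kappa> \<and>
              (\<forall>s\<in>{-\<delta><..<\<delta>}.
                 \<kappa> s = \<kappa>m s \<and> mode_periodic m (p s) \<and> (\<forall>l\<ge>1. p s (l * m) = pm s l)) \<and>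
              ((\<forall>l\<ge>1. l \<noteq> m \<longrightarrow> a l \<noteq> a m) \<longrightarrow>
                 locally_unique_branch a (2 / a m) \<delta> p \<kappa>))))
     \<and>
     (\<forall>m\<ge>1. a m > 0 \<and> summable (\<lambda>j. (real j)\<^sup>2 * (a j)\<^sup>2) \<and> Gcd {l. l \<ge> 1 \<and> a l = a m} > 1 \<longrightarrow>
        (\<forall>\<delta> p \<kappa>. nontrivial_branch a (2 / a m) \<delta> p \<kappa> \<longrightarrow>
           (\<exists>\<delta>'\<in>{0<..\<delta>}. \<forall>s\<in>{-\<delta>'<..<\<delta>'}.
              mode_periodic (Gcd {l. l \<ge> 1 \<and> a l = a m}) (p s))))"
proof -
  obtain C0 where C0: "\<And>l. l \<ge> 1 \<Longrightarrow> real l * \<bar>a l\<bar> \<le> C0"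
    using bounded by (auto simp: bdd_above_def)
  have "real l * \<bar>a l\<bar> \<le> max 1 C0" for l
    using C0[of l] by (cases "l \<ge> 1") (auto simp: max.coboundedI2 not_le)
  then interpret bounded_coeffs a "max 1 C0" by unfold_locales auto
  show ?thesis
  proof (intro conjI allI impI)
    fix m :: nat assume m: "1 \<le> m" and *: "a m > 0 \<and> (\<forall>l>1. a (l * m) \<noteq> a m)"
    let ?b = "rescaled_coeffs m a"
    interpret b: bounded_coeffs ?b "max 1 C0" by (rule bounded_coeffs_rescaled[OF m])
    have b1: "?b 1 = a m" by (simp add: rescaled_coeffs_def)
    have simple: "?b l \<noteq> ?b 1" if "l > 1" for l using * that by (simp add: rescaled_coeffs_def)
    obtain c where c: "c > 0" "\<And>l. l \<ge> 1 \<Longrightarrow> ?b l \<noteq> ?b 1 \<Longrightarrow> c \<le> \<bar>?b 1 - ?b l\<bar>"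
      using b.spectral_gap[of 1] * b1 by metis
    interpret b: simple_first_mode ?b "max 1 C0" c
      by unfold_locales (use * c simple in \<open>auto simp: b1 simp del: One_nat_def\<close>)
    show "\<exists>\<delta> pm \<kappa>m. first_mode_branch ?b (2 / a m) \<delta> pm \<kappa>m"
      using b.first_mode_branch_exists unfolding b1 by blast
    fix \<delta> pm \<kappa>m assume branch: "first_mode_branch ?b (2 / a m) \<delta> pm \<kappa>m"
    have nt: "nontrivial_branch ?b (2 / a m) \<delta> pm \<kappa>m" using branch by (simp add: first_mode_branch_def)
    show unique: "locally_unique_branch ?b (2 / a m) \<delta> pm \<kappa>m"
      using b.first_mode_branch_locally_unique[OF b.a1_pos simple] branch unfolding b1 by blast
    show "\<exists>p \<kappa>. nontrivial_branch a (2 / a m) \<delta> p \<kappa> \<and>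
        (\<forall>s\<in>{-\<delta><..<\<delta>}. \<kappa> s = \<kappa>m s \<and> mode_periodic m (p s) \<and> (\<forall>l\<ge>1. p s (l * m) = pm s l)) \<and>
        ((\<forall>l\<ge>1. l \<noteq> m \<longrightarrow> a l \<noteq> a m) \<longrightarrow> locally_unique_branch a (2 / a m) \<delta> p \<kappa>)"
    proof (intro exI[of _ "\<lambda>s. spread m (pm s)"] exI[of _ \<kappa>m] conjI impI)
      show "nontrivial_branch a (2 / a m) \<delta> (\<lambda>s. spread m (pm s)) \<kappa>m" by (rule spread_branch[OF m nt])
      show "\<forall>s\<in>{-\<delta><..<\<delta>}. \<kappa>m s = \<kappa>m s \<and> mode_periodic m (spread m (pm s))
          \<and> (\<forall>l\<ge>1. spread m (pm s) (l * m) = pm s l)"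
        using m by (simp add: mode_periodic_def) (simp add: spread_def)
      show "locally_unique_branch a (2 / a m) \<delta> (\<lambda>s. spread m (pm s)) \<kappa>m"
        if "\<forall>l\<ge>1. l \<noteq> m \<longrightarrow> a l \<noteq> a m"
        using spread_branch_locally_unique[OF m _ _ unique] * that by blast
    qed
  next
    fix m :: nat and \<delta> p \<kappa>
    let ?g = "Gcd {l. l \<ge> 1 \<and> a l = a m}"
    assume "a m > 0 \<and> summable (\<lambda>j. (real j)\<^sup>2 * (a j)\<^sup>2) \<and> ?g > 1"
      and "nontrivial_branch a (2 / a m) \<delta> p \<kappa>"
    then show "\<exists>\<delta>'\<in>{0<..\<delta>}. \<forall>s\<in>{-\<delta>'<..<\<delta>'}. mode_periodic ?g (p s)"
      by (intro branch_mode_periodic) (auto intro!: Gcd_dvd)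
  qed
qed

end
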